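(* Let $\mathcal{H}$ be a pre-Hilbert category and $X$ an object. Then $\mathrm{ClSub}(X)$ is an orthomodular lattice: for all $m,n\in\mathrm{ClSub}(X)$ with $m\le n$, one has $m\vee(m^\perp\wedge n)=n$.
   Context: A $\dagger$-category is a category $\mathcal{H}$ with a functor $\dagger:\mathcal{H}^{\mathrm{op}}\to\mathcal{H}$ that is the identity on objects and satisfies $f^{\dagger\dagger}=f$. A morphism $m$ is a $\dagger$-mono if $m^\dagger m=\mathrm{id}$, a $\dagger$-epi if $mm^\dagger=\mathrm{id}$, and a $\dagger$-iso if both. A pre-Hilbert category is a $\dagger$-category such that: it has finite $\dagger$-biproducts (finite biproducts, including a zero object $0$, with projections $\pi$ and injections $\kappa$ satisfying $\pi^\dagger=\kappa$); it has finite $\dagger$-equalisers (equalisers that are $\dagger$-monos); every $\dagger$-mono is a kernel of some morphism; and it is symmetric $\dagger$-monoidal (symmetric monoidal with $(f\otimes g)^\dagger=f^\dagger\otimes g^\dagger$ and coherence isomorphisms $\dagger$-isos). Kernels $\ker(f)$ are chosen to be $\dagger$-monos. A subobject of $X$ is an equivalence class of monos into $X$ (modulo isomorphism of domains commuting with the monos), ordered by $M\le N$ iff $m=nf$ for some $f$; $\mathrm{ClSub}(X)$ is the poset of subobjects representable by a $\dagger$-mono. In $\mathrm{ClSub}(X)$ the meet $m\wedge n$ is given by the pullback of $m$ and $n$, and the join $m\vee n$ is the $\dagger$-mono part of the factorisation of $[m,n]:M\oplus N\to X$ as an epi followed by a $\dagger$-mono. For a $\dagger$-mono $m$, $m^\perp=\ker(m^\dagger)$.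 *)

theory Defs
  imports "HOL-Algebra.Lattice"
begin

section \<open>Categories\<close>

text \<open>
  Composition is written in applicative order, and composites, domains and
  identities are constrained only on the carriers \<open>Obj\<close> and \<open>Arr\<close>.
\<close>

record ('o, 'm) category =
  Obj :: "'o set"
  Arr :: "'m set"
  Dom :: "'m \<Rightarrow> 'o"
  Cod :: "'m \<Rightarrow> 'o"
  Id :: "'o \<Rightarrow> 'm" (\<open>\<one>\<index>\<close>)
  Comp :: "'m \<Rightarrow> 'm \<Rightarrow> 'm" (infixl \<open>\<cdot>\<index>\<close> 70)

definition Hom :: "('o, 'm, 'r) category_scheme \<Rightarrow> 'o \<Rightarrow> 'o \<Rightarrow> 'm set" where
  "Hom C A B = {f \<in> Arr C. Dom C f = A \<and> Cod C f = B}"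

locale category =
  fixes C (structure)
  assumes Dom_closed: "f \<in> Arr C \<Longrightarrow> Dom C f \<in> Obj C"
    and Cod_closed: "f \<in> Arr C \<Longrightarrow> Cod C f \<in> Obj C"
    and Id_closed: "A \<in> Obj C \<Longrightarrow> \<one> A \<in> Hom C A A"
    and Comp_closed: "\<lbrakk>f \<in> Hom C A B; g \<in> Hom C B D\<rbrakk> \<Longrightarrow> g \<cdot> f \<in> Hom C A D"
    and Id_left: "f \<in> Hom C A B \<Longrightarrow> \<one> B \<cdot> f = f"
    and Id_right: "f \<in> Hom C A B \<Longrightarrow> f \<cdot> \<one> A = f"
    and Comp_assoc:
      "\<lbrakk>f \<in> Hom C A B; g \<in> Hom C B D; h \<in> Hom C D E\<rbrakk> \<Longrightarrow> (h \<cdot> g) \<cdot> f = h \<cdot> (g \<cdot> f)"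

definition mono_arr :: "('o, 'm, 'r) category_scheme \<Rightarrow> 'm \<Rightarrow> bool" where
  "mono_arr C m \<longleftrightarrow> m \<in> Arr C \<and>
    (\<forall>W. \<forall>f\<in>Hom C W (Dom C m). \<forall>g\<in>Hom C W (Dom C m). m \<cdot>\<^bsub>C\<^esub> f = m \<cdot>\<^bsub>C\<^esub> g \<longrightarrow> f = g)"

definition epi_arr :: "('o, 'm, 'r) category_scheme \<Rightarrow> 'm \<Rightarrow> bool" where
  "epi_arr C e \<longleftrightarrow> e \<in> Arr C \<and>
    (\<forall>W. \<forall>f\<in>Hom C (Cod C e) W. \<forall>g\<in>Hom C (Cod C e) W. f \<cdot>\<^bsub>C\<^esub> e = g \<cdot>\<^bsub>C\<^esub> e \<longrightarrow> f = g)"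

definition iso_arr :: "('o, 'm, 'r) category_scheme \<Rightarrow> 'm \<Rightarrow> bool" where
  "iso_arr C i \<longleftrightarrow> i \<in> Arr C \<and>
    (\<exists>j\<in>Hom C (Cod C i) (Dom C i). j \<cdot>\<^bsub>C\<^esub> i = \<one>\<^bsub>C\<^esub> (Dom C i) \<and> i \<cdot>\<^bsub>C\<^esub> j = \<one>\<^bsub>C\<^esub> (Cod C i))"

definition zero_object :: "('o, 'm, 'r) category_scheme \<Rightarrow> 'o \<Rightarrow> bool" where
  "zero_object C Z \<longleftrightarrow> Z \<in> Obj C \<and>
    (\<forall>A\<in>Obj C. (\<exists>!f. f \<in> Hom C A Z) \<and> (\<exists>!f. f \<in> Hom C Z A))"

text \<open>In a category with a zero object, the following arrow is well defined.\<close>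

definition zero_arr :: "('o, 'm, 'r) category_scheme \<Rightarrow> 'o \<Rightarrow> 'o \<Rightarrow> 'm" where
  "zero_arr C A B =
    (THE h. \<exists>Z u v. zero_object C Z \<and> u \<in> Hom C A Z \<and> v \<in> Hom C Z B \<and> h = v \<cdot>\<^bsub>C\<^esub> u)"

definition is_product ::
  "('o, 'm, 'r) category_scheme \<Rightarrow> 'o \<Rightarrow> 'o \<Rightarrow> 'o \<Rightarrow> 'm \<Rightarrow> 'm \<Rightarrow> bool" where
  "is_product C A B P p1 p2 \<longleftrightarrow> p1 \<in> Hom C P A \<and> p2 \<in> Hom C P B \<and>
    (\<forall>W. \<forall>f\<in>Hom C W A. \<forall>g\<in>Hom C W B.
      \<exists>!h. h \<in> Hom C W P \<and> p1 \<cdot>\<^bsub>C\<^esub> h = f \<and> p2 \<cdot>\<^bsub>C\<^esub> h = g)"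

definition is_coproduct ::
  "('o, 'm, 'r) category_scheme \<Rightarrow> 'o \<Rightarrow> 'o \<Rightarrow> 'o \<Rightarrow> 'm \<Rightarrow> 'm \<Rightarrow> bool" where
  "is_coproduct C A B P k1 k2 \<longleftrightarrow> k1 \<in> Hom C A P \<and> k2 \<in> Hom C B P \<and>
    (\<forall>W. \<forall>f\<in>Hom C A W. \<forall>g\<in>Hom C B W.
      \<exists>!h. h \<in> Hom C P W \<and> h \<cdot>\<^bsub>C\<^esub> k1 = f \<and> h \<cdot>\<^bsub>C\<^esub> k2 = g)"

definition is_biproduct ::
  "('o, 'm, 'r) category_scheme \<Rightarrow> 'o \<Rightarrow> 'o \<Rightarrow> 'o \<Rightarrow> 'm \<Rightarrow> 'm \<Rightarrow> 'm \<Rightarrow> 'm \<Rightarrow> bool" where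
  "is_biproduct C A B P p1 p2 k1 k2 \<longleftrightarrow>
    is_product C A B P p1 p2 \<and> is_coproduct C A B P k1 k2 \<and>
    p1 \<cdot>\<^bsub>C\<^esub> k1 = \<one>\<^bsub>C\<^esub> A \<and> p2 \<cdot>\<^bsub>C\<^esub> k2 = \<one>\<^bsub>C\<^esub> B \<and>
    p1 \<cdot>\<^bsub>C\<^esub> k2 = zero_arr C B A \<and> p2 \<cdot>\<^bsub>C\<^esub> k1 = zero_arr C A B"

definition is_equaliser :: "('o, 'm, 'r) category_scheme \<Rightarrow> 'm \<Rightarrow> 'm \<Rightarrow> 'm \<Rightarrow> bool" where
  "is_equaliser C e f g \<longleftrightarrow>
    e \<in> Arr C \<and> f \<in> Hom C (Cod C e) (Cod C f) \<and> g \<in> Hom C (Cod C e) (Cod C f) \<and>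
    f \<cdot>\<^bsub>C\<^esub> e = g \<cdot>\<^bsub>C\<^esub> e \<and>
    (\<forall>W. \<forall>h\<in>Hom C W (Cod C e). f \<cdot>\<^bsub>C\<^esub> h = g \<cdot>\<^bsub>C\<^esub> h \<longrightarrow>
      (\<exists>!u. u \<in> Hom C W (Dom C e) \<and> e \<cdot>\<^bsub>C\<^esub> u = h))"

definition is_kernel :: "('o, 'm, 'r) category_scheme \<Rightarrow> 'm \<Rightarrow> 'm \<Rightarrow> bool" where
  "is_kernel C k f \<longleftrightarrow> is_equaliser C k f (zero_arr C (Dom C f) (Cod C f))"

definition is_pullback ::
  "('o, 'm, 'r) category_scheme \<Rightarrow> 'm \<Rightarrow> 'm \<Rightarrow> 'm \<Rightarrow> 'm \<Rightarrow> bool" where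
  "is_pullback C f g p q \<longleftrightarrow>
    f \<in> Arr C \<and> g \<in> Arr C \<and> Cod C f = Cod C g \<and>
    p \<in> Hom C (Dom C p) (Dom C f) \<and> q \<in> Hom C (Dom C p) (Dom C g) \<and>
    f \<cdot>\<^bsub>C\<^esub> p = g \<cdot>\<^bsub>C\<^esub> q \<and>
    (\<forall>W. \<forall>u\<in>Hom C W (Dom C f). \<forall>v\<in>Hom C W (Dom C g). f \<cdot>\<^bsub>C\<^esub> u = g \<cdot>\<^bsub>C\<^esub> v \<longrightarrow>
      (\<exists>!w. w \<in> Hom C W (Dom C p) \<and> p \<cdot>\<^bsub>C\<^esub> w = u \<and> q \<cdot>\<^bsub>C\<^esub> w = v))"


section \<open>Dagger categories\<close>

record ('o, 'm) dagger_category = "('o, 'm) category" +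
  Dag :: "'m \<Rightarrow> 'm" (\<open>_\<^sup>\<dagger>\<index>\<close> [1000] 1000)

locale dagger_category = category C for C (structure) +
  assumes Dag_closed: "f \<in> Hom C A B \<Longrightarrow> f\<^sup>\<dagger> \<in> Hom C B A"
    and Dag_Id: "A \<in> Obj C \<Longrightarrow> (\<one> A)\<^sup>\<dagger> = \<one> A"
    and Dag_Comp: "\<lbrakk>f \<in> Hom C A B; g \<in> Hom C B D\<rbrakk> \<Longrightarrow> (g \<cdot> f)\<^sup>\<dagger> = f\<^sup>\<dagger> \<cdot> g\<^sup>\<dagger>"
    and Dag_Dag: "f \<in> Arr C \<Longrightarrow> (f\<^sup>\<dagger>)\<^sup>\<dagger> = f"

definition dagger_mono :: "('o, 'm, 'r) dagger_category_scheme \<Rightarrow> 'm \<Rightarrow> bool" where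
  "dagger_mono C m \<longleftrightarrow> m \<in> Arr C \<and> m\<^sup>\<dagger>\<^bsub>C\<^esub> \<cdot>\<^bsub>C\<^esub> m = \<one>\<^bsub>C\<^esub> (Dom C m)"

definition dagger_epi :: "('o, 'm, 'r) dagger_category_scheme \<Rightarrow> 'm \<Rightarrow> bool" where
  "dagger_epi C m \<longleftrightarrow> m \<in> Arr C \<and> m \<cdot>\<^bsub>C\<^esub> m\<^sup>\<dagger>\<^bsub>C\<^esub> = \<one>\<^bsub>C\<^esub> (Cod C m)"

definition dagger_iso :: "('o, 'm, 'r) dagger_category_scheme \<Rightarrow> 'm \<Rightarrow> bool" where
  "dagger_iso C m \<longleftrightarrow> dagger_mono C m \<and> dagger_epi C m"

definition is_dagger_biproduct ::
  "('o, 'm, 'r) dagger_category_scheme \<Rightarrow> 'o \<Rightarrow> 'o \<Rightarrow> 'o \<Rightarrow> 'm \<Rightarrow> 'm \<Rightarrow> 'm \<Rightarrow> 'm \<Rightarrow> bool" where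
  "is_dagger_biproduct C A B P p1 p2 k1 k2 \<longleftrightarrow>
    is_biproduct C A B P p1 p2 k1 k2 \<and> p1\<^sup>\<dagger>\<^bsub>C\<^esub> = k1 \<and> p2\<^sup>\<dagger>\<^bsub>C\<^esub> = k2"


section \<open>Symmetric dagger monoidal categories\<close>

record ('o, 'm) monoidal_dagger_category = "('o, 'm) dagger_category" +
  TensorObj :: "'o \<Rightarrow> 'o \<Rightarrow> 'o" (infixr \<open>\<odot>\<index>\<close> 75)
  TensorArr :: "'m \<Rightarrow> 'm \<Rightarrow> 'm" (infixr \<open>\<otimes>\<index>\<close> 75)
  Unit :: 'o
  Assoc :: "'o \<Rightarrow> 'o \<Rightarrow> 'o \<Rightarrow> 'm" (\<open>\<alpha>\<index>\<close>)
  LUnit :: "'o \<Rightarrow> 'm" (\<open>\<lambda>\<^sub>U\<index>\<close>)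
  RUnit :: "'o \<Rightarrow> 'm" (\<open>\<rho>\<^sub>U\<index>\<close>)
  Braid :: "'o \<Rightarrow> 'o \<Rightarrow> 'm" (\<open>\<sigma>\<index>\<close>)

locale symmetric_monoidal_category = category C for C (structure) +
  assumes TensorObj_closed: "\<lbrakk>A \<in> Obj C; B \<in> Obj C\<rbrakk> \<Longrightarrow> A \<odot> B \<in> Obj C"
    and Unit_closed: "Unit C \<in> Obj C"
    and TensorArr_closed:
      "\<lbrakk>f \<in> Hom C A B; g \<in> Hom C A' B'\<rbrakk> \<Longrightarrow> f \<otimes> g \<in> Hom C (A \<odot> A') (B \<odot> B')"
    and Tensor_Id: "\<lbrakk>A \<in> Obj C; B \<in> Obj C\<rbrakk> \<Longrightarrow> \<one> A \<otimes> \<one> B = \<one> (A \<odot> B)"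
    and Tensor_Comp:
      "\<lbrakk>f \<in> Hom C A B; g \<in> Hom C B D; f' \<in> Hom C A' B'; g' \<in> Hom C B' D'\<rbrakk>
        \<Longrightarrow> (g \<cdot> f) \<otimes> (g' \<cdot> f') = (g \<otimes> g') \<cdot> (f \<otimes> f')"
    and Assoc_closed: "\<lbrakk>A \<in> Obj C; B \<in> Obj C; D \<in> Obj C\<rbrakk>
        \<Longrightarrow> \<alpha> A B D \<in> Hom C ((A \<odot> B) \<odot> D) (A \<odot> (B \<odot> D))"
    and Assoc_iso: "\<lbrakk>A \<in> Obj C; B \<in> Obj C; D \<in> Obj C\<rbrakk> \<Longrightarrow> iso_arr C (\<alpha> A B D)"
    and Assoc_natural:
      "\<lbrakk>f \<in> Hom C A A'; g \<in> Hom C B B'; h \<in> Hom C D D'\<rbrakk>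
        \<Longrightarrow> \<alpha> A' B' D' \<cdot> ((f \<otimes> g) \<otimes> h) = (f \<otimes> (g \<otimes> h)) \<cdot> \<alpha> A B D"
    and LUnit_closed: "A \<in> Obj C \<Longrightarrow> \<lambda>\<^sub>U A \<in> Hom C (Unit C \<odot> A) A"
    and LUnit_iso: "A \<in> Obj C \<Longrightarrow> iso_arr C (\<lambda>\<^sub>U A)"
    and LUnit_natural: "f \<in> Hom C A B \<Longrightarrow> \<lambda>\<^sub>U B \<cdot> (\<one> (Unit C) \<otimes> f) = f \<cdot> \<lambda>\<^sub>U A"
    and RUnit_closed: "A \<in> Obj C \<Longrightarrow> \<rho>\<^sub>U A \<in> Hom C (A \<odot> Unit C) A"
    and RUnit_iso: "A \<in> Obj C \<Longrightarrow> iso_arr C (\<rho>\<^sub>U A)"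
    and RUnit_natural: "f \<in> Hom C A B \<Longrightarrow> \<rho>\<^sub>U B \<cdot> (f \<otimes> \<one> (Unit C)) = f \<cdot> \<rho>\<^sub>U A"
    and Braid_closed:
      "\<lbrakk>A \<in> Obj C; B \<in> Obj C\<rbrakk> \<Longrightarrow> \<sigma> A B \<in> Hom C (A \<odot> B) (B \<odot> A)"
    and Braid_natural:
      "\<lbrakk>f \<in> Hom C A A'; g \<in> Hom C B B'\<rbrakk> \<Longrightarrow> \<sigma> A' B' \<cdot> (f \<otimes> g) = (g \<otimes> f) \<cdot> \<sigma> A B"
    and symmetry: "\<lbrakk>A \<in> Obj C; B \<in> Obj C\<rbrakk> \<Longrightarrow> \<sigma> B A \<cdot> \<sigma> A B = \<one> (A \<odot> B)"
    and pentagon: "\<lbrakk>A \<in> Obj C; B \<in> Obj C; D \<in> Obj C; E \<in> Obj C\<rbrakk>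
        \<Longrightarrow> \<alpha> A B (D \<odot> E) \<cdot> \<alpha> (A \<odot> B) D E
          = (\<one> A \<otimes> \<alpha> B D E) \<cdot> (\<alpha> A (B \<odot> D) E \<cdot> (\<alpha> A B D \<otimes> \<one> E))"
    and triangle: "\<lbrakk>A \<in> Obj C; B \<in> Obj C\<rbrakk>
        \<Longrightarrow> (\<one> A \<otimes> \<lambda>\<^sub>U B) \<cdot> \<alpha> A (Unit C) B = \<rho>\<^sub>U A \<otimes> \<one> B"
    and hexagon: "\<lbrakk>A \<in> Obj C; B \<in> Obj C; D \<in> Obj C\<rbrakk>
        \<Longrightarrow> \<alpha> B D A \<cdot> (\<sigma> A (B \<odot> D) \<cdot> \<alpha> A B D)
          = (\<one> B \<otimes> \<sigma> A D) \<cdot> (\<alpha> B A D \<cdot> (\<sigma> A B \<otimes> \<one> D))"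

locale symmetric_dagger_monoidal_category =
  dagger_category C + symmetric_monoidal_category C for C (structure) +
  assumes Dag_Tensor: "\<lbrakk>f \<in> Arr C; g \<in> Arr C\<rbrakk> \<Longrightarrow> (f \<otimes> g)\<^sup>\<dagger> = f\<^sup>\<dagger> \<otimes> g\<^sup>\<dagger>"
    and Assoc_dagger_iso:
      "\<lbrakk>A \<in> Obj C; B \<in> Obj C; D \<in> Obj C\<rbrakk> \<Longrightarrow> dagger_iso C (\<alpha> A B D)"
    and LUnit_dagger_iso: "A \<in> Obj C \<Longrightarrow> dagger_iso C (\<lambda>\<^sub>U A)"
    and RUnit_dagger_iso: "A \<in> Obj C \<Longrightarrow> dagger_iso C (\<rho>\<^sub>U A)"
    and Braid_dagger_iso: "\<lbrakk>A \<in> Obj C; B \<in> Obj C\<rbrakk> \<Longrightarrow> dagger_iso C (\<sigma> A B)"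


section \<open>Pre-Hilbert categories\<close>

locale pre_hilbert_category = symmetric_dagger_monoidal_category C for C (structure) +
  assumes zero_object_exists: "\<exists>Z. zero_object C Z"
    and dagger_biproduct_exists: "\<lbrakk>A \<in> Obj C; B \<in> Obj C\<rbrakk>
        \<Longrightarrow> \<exists>P p1 p2 k1 k2. is_dagger_biproduct C A B P p1 p2 k1 k2"
    and dagger_equaliser_exists: "\<lbrakk>f \<in> Hom C A B; g \<in> Hom C A B\<rbrakk>
        \<Longrightarrow> \<exists>e. is_equaliser C e f g \<and> dagger_mono C e"
    and dagger_mono_is_kernel: "dagger_mono C m \<Longrightarrow> \<exists>f. is_kernel C m f"


section \<open>Closed subobjects\<close>

definition subobject_class ::
  "('o, 'm, 'r) category_scheme \<Rightarrow> 'm \<Rightarrow> 'm set" where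
  "subobject_class C m = {n. mono_arr C n \<and> Cod C n = Cod C m \<and>
    (\<exists>i\<in>Hom C (Dom C n) (Dom C m). iso_arr C i \<and> n = m \<cdot>\<^bsub>C\<^esub> i)}"

definition subobjects :: "('o, 'm, 'r) category_scheme \<Rightarrow> 'o \<Rightarrow> 'm set set" where
  "subobjects C X = {subobject_class C m |m. mono_arr C m \<and> Cod C m = X}"

definition subobject_le ::
  "('o, 'm, 'r) category_scheme \<Rightarrow> 'm set \<Rightarrow> 'm set \<Rightarrow> bool" where
  "subobject_le C M N \<longleftrightarrow>
    (\<exists>m\<in>M. \<exists>n\<in>N. \<exists>f\<in>Hom C (Dom C m) (Dom C n). m = n \<cdot>\<^bsub>C\<^esub> f)"

definition ClSub :: "('o, 'm, 'r) dagger_category_scheme \<Rightarrow> 'o \<Rightarrow> 'm set gorder" where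
  "ClSub C X =
    \<lparr>carrier = {M \<in> subobjects C X. \<exists>m\<in>M. dagger_mono C m},
     eq = (=),
     le = subobject_le C\<rparr>"

text \<open>
  The operations below are given by their categorical constructions on
  representing arrows; each definite description picks the unique resulting
  subobject, which does not depend on the representatives and on the choice of
  limit, biproduct or factorisation.
\<close>

definition cl_meet ::
  "('o, 'm, 'r) dagger_category_scheme \<Rightarrow> 'm set \<Rightarrow> 'm set \<Rightarrow> 'm set" where
  "cl_meet C M N = (THE U. \<exists>m n p q.
    m \<in> M \<and> dagger_mono C m \<and> n \<in> N \<and> dagger_mono C n \<and>
    is_pullback C m n p q \<and> U = subobject_class C (m \<cdot>\<^bsub>C\<^esub> p))"

text \<open>Here \<open>h\<close> is the cotuple of \<open>m\<close> and \<open>n\<close>, factored as \<open>h = d \<cdot> e\<close>.\<close>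

definition cl_join ::
  "('o, 'm, 'r) dagger_category_scheme \<Rightarrow> 'm set \<Rightarrow> 'm set \<Rightarrow> 'm set" where
  "cl_join C M N = (THE U. \<exists>m n P p1 p2 k1 k2 h e d.
    m \<in> M \<and> dagger_mono C m \<and> n \<in> N \<and> dagger_mono C n \<and>
    is_dagger_biproduct C (Dom C m) (Dom C n) P p1 p2 k1 k2 \<and>
    h \<in> Hom C P (Cod C m) \<and> h \<cdot>\<^bsub>C\<^esub> k1 = m \<and> h \<cdot>\<^bsub>C\<^esub> k2 = n \<and>
    epi_arr C e \<and> dagger_mono C d \<and> Dom C e = P \<and> Cod C e = Dom C d \<and>
    h = d \<cdot>\<^bsub>C\<^esub> e \<and> U = subobject_class C d)"

definition cl_perp :: "('o, 'm, 'r) dagger_category_scheme \<Rightarrow> 'm set \<Rightarrow> 'm set" where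
  "cl_perp C M = (THE U. \<exists>m k.
    m \<in> M \<and> dagger_mono C m \<and> is_kernel C k (m\<^sup>\<dagger>\<^bsub>C\<^esub>) \<and> dagger_mono C k \<and>
    U = subobject_class C k)"


section \<open>Orthomodular lattices\<close>

locale orthocomplemented_lattice = bounded_lattice L for L (structure) +
  fixes perp :: "'a \<Rightarrow> 'a"
  assumes perp_closed: "x \<in> carrier L \<Longrightarrow> perp x \<in> carrier L"
    and perp_perp: "x \<in> carrier L \<Longrightarrow> perp (perp x) = x"
    and perp_antimono:
      "\<lbrakk>x \<in> carrier L; y \<in> carrier L; x \<sqsubseteq> y\<rbrakk> \<Longrightarrow> perp y \<sqsubseteq> perp x"
    and join_perp: "x \<in> carrier L \<Longrightarrow> x \<squnion> perp x = \<top>"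
    and meet_perp: "x \<in> carrier L \<Longrightarrow> x \<sqinter> perp x = \<bottom>"

locale orthomodular_lattice = orthocomplemented_lattice L perp for L (structure) and perp +
  assumes orthomodular:
    "\<lbrakk>x \<in> carrier L; y \<in> carrier L; x \<sqsubseteq> y\<rbrakk> \<Longrightarrow> x \<squnion> (perp x \<sqinter> y) = y"

end

theory Submission
  imports Defs
begin

text \<open>
  Write \<open>a \<preceq> b\<close> if \<open>a\<close> factors through \<open>b\<close>, and call \<open>a\<close> and \<open>b\<close> orthogonal if \<open>a\<^sup>\<dagger> b = 0\<close>.
  As every \<open>\<dagger>\<close>-mono \<open>m\<close> is a kernel, \<open>h \<preceq> m\<close> holds iff every arrow orthogonal to \<open>m\<close> is
  orthogonal to \<open>h\<close>; and by construction \<open>h \<preceq> m\<^sup>\<bottom>\<close> holds iff \<open>m\<close> is orthogonal to \<open>h\<close>.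
  Most of the lattice structure follows from this Galois connection, and so does the factorisation
  of an arrow as an epi followed by a \<open>\<dagger>\<close>-mono.
  For the orthomodular law let \<open>j = m \<or> (m\<^sup>\<bottom> \<and> n) \<le> n\<close>. Then \<open>n \<and> j\<^sup>\<bottom> \<le> j \<and> j\<^sup>\<bottom> = 0\<close>.
  Write \<open>j = n w\<close>, where \<open>w\<close> is a \<open>\<dagger>\<close>-mono; if \<open>v = ker(w\<^sup>\<dagger>)\<close>, then \<open>n v\<close> lies below \<open>n\<close> and
  \<open>j\<^sup>\<bottom>\<close>, so \<open>v = 0\<close>, hence \<open>w = v\<^sup>\<bottom>\<close> is invertible and \<open>j = n\<close>.
\<close>

text \<open>Neither arrow is assumed to be mono, so the relation also applies to test arrows,
  cotuples and zero arrows. Between monos into a common object it is the order of the subobjects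
  that they represent.\<close>

definition below :: "('o, 'm, 'r) category_scheme \<Rightarrow> 'm \<Rightarrow> 'm \<Rightarrow> bool" where
  "below C a b \<longleftrightarrow> (\<exists>f\<in>Hom C (Dom C a) (Dom C b). a = b \<cdot>\<^bsub>C\<^esub> f)"

text \<open>Meant for arbitrary arrows into a common object. For Hilbert spaces the equation says
  that the ranges of \<open>a\<close> and \<open>b\<close> are orthogonal.\<close>

definition orth :: "('o, 'm, 'r) dagger_category_scheme \<Rightarrow> 'm \<Rightarrow> 'm \<Rightarrow> bool" where
  "orth C a b \<longleftrightarrow> a\<^sup>\<dagger>\<^bsub>C\<^esub> \<cdot>\<^bsub>C\<^esub> b = zero_arr C (Dom C b) (Dom C a)"

section \<open>Rules for arrows, bounds of pairs and universal properties\<close>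

lemma in_Hom_iff: "f \<in> Hom C A B \<longleftrightarrow> f \<in> Arr C \<and> Dom C f = A \<and> Cod C f = B"
  by (auto simp: Hom_def)

lemma least_Upper_pairI:
  fixes L (structure)
  assumes "x \<in> carrier L" "y \<in> carrier L" "s \<in> carrier L" "x \<sqsubseteq> s" "y \<sqsubseteq> s"
    and "\<And>z. \<lbrakk>z \<in> carrier L; x \<sqsubseteq> z; y \<sqsubseteq> z\<rbrakk> \<Longrightarrow> s \<sqsubseteq> z"
  shows "least L s (Upper L {x, y})"
  using assms by (auto simp: least_def Upper_def)

lemma greatest_Lower_pairI:
  fixes L (structure)
  assumes "x \<in> carrier L" "y \<in> carrier L" "s \<in> carrier L" "s \<sqsubseteq> x" "s \<sqsubseteq> y"
    and "\<And>z. \<lbrakk>z \<in> carrier L; z \<sqsubseteq> x; z \<sqsubseteq> y\<rbrakk> \<Longrightarrow> z \<sqsubseteq> s"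
  shows "greatest L s (Lower L {x, y})"
  using assms by (auto simp: greatest_def Lower_def)

lemma Hom_Dom: "f \<in> Hom C A B \<Longrightarrow> Dom C f = A"
  and Hom_Cod: "f \<in> Hom C A B \<Longrightarrow> Cod C f = B"
  by (simp_all add: Hom_def)

lemma mono_arrD:
  assumes "mono_arr C m" "m \<in> Hom C A B" "f \<in> Hom C W A" "g \<in> Hom C W A" "m \<cdot>\<^bsub>C\<^esub> f = m \<cdot>\<^bsub>C\<^esub> g"
  shows "f = g"
  using assms Hom_Dom[OF assms(2)] unfolding mono_arr_def by blast

lemma mono_arrI:
  assumes "m \<in> Hom C A B"
    and "\<And>W f g. \<lbrakk>f \<in> Hom C W A; g \<in> Hom C W A; m \<cdot>\<^bsub>C\<^esub> f = m \<cdot>\<^bsub>C\<^esub> g\<rbrakk> \<Longrightarrow> f = g"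
  shows "mono_arr C m"
  using assms unfolding mono_arr_def in_Hom_iff[of m] by blast

lemma epi_arrD:
  assumes "epi_arr C e" "e \<in> Hom C A B" "f \<in> Hom C B W" "g \<in> Hom C B W" "f \<cdot>\<^bsub>C\<^esub> e = g \<cdot>\<^bsub>C\<^esub> e"
  shows "f = g"
  using assms Hom_Cod[OF assms(2)] unfolding epi_arr_def by blast

lemma epi_arrI:
  assumes "e \<in> Hom C A B"
    and "\<And>W f g. \<lbrakk>f \<in> Hom C B W; g \<in> Hom C B W; f \<cdot>\<^bsub>C\<^esub> e = g \<cdot>\<^bsub>C\<^esub> e\<rbrakk> \<Longrightarrow> f = g"
  shows "epi_arr C e"
  using assms unfolding epi_arr_def in_Hom_iff[of e] by blast

lemma is_equaliserD:
  assumes "is_equaliser C e f g" "f \<in> Hom C A B"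
  shows "e \<in> Hom C (Dom C e) A" "f \<cdot>\<^bsub>C\<^esub> e = g \<cdot>\<^bsub>C\<^esub> e"
    "\<lbrakk>h \<in> Hom C W A; f \<cdot>\<^bsub>C\<^esub> h = g \<cdot>\<^bsub>C\<^esub> h\<rbrakk> \<Longrightarrow> \<exists>u\<in>Hom C W (Dom C e). e \<cdot>\<^bsub>C\<^esub> u = h"
proof -
  have e: "e \<in> Arr C" "f \<in> Hom C (Cod C e) (Cod C f)" "f \<cdot>\<^bsub>C\<^esub> e = g \<cdot>\<^bsub>C\<^esub> e"
    and univ: "\<forall>W. \<forall>h\<in>Hom C W (Cod C e). f \<cdot>\<^bsub>C\<^esub> h = g \<cdot>\<^bsub>C\<^esub> h \<longrightarrow>
      (\<exists>!u. u \<in> Hom C W (Dom C e) \<and> e \<cdot>\<^bsub>C\<^esub> u = h)"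
    using assms(1) unfolding is_equaliser_def by iprover+
  have A: "Cod C e = A" using Hom_Dom[OF e(2)] Hom_Dom[OF assms(2)] by simp
  show "e \<in> Hom C (Dom C e) A" using e(1) A by (simp add: Hom_def)
  show "f \<cdot>\<^bsub>C\<^esub> e = g \<cdot>\<^bsub>C\<^esub> e" by (fact e(3))
  assume "h \<in> Hom C W A" "f \<cdot>\<^bsub>C\<^esub> h = g \<cdot>\<^bsub>C\<^esub> h"
  then have "\<exists>!u. u \<in> Hom C W (Dom C e) \<and> e \<cdot>\<^bsub>C\<^esub> u = h" using univ unfolding A by simp
  then show "\<exists>u\<in>Hom C W (Dom C e). e \<cdot>\<^bsub>C\<^esub> u = h" by blast
qed

lemma is_coproductD:
  assumes "is_coproduct C A B P k1 k2"
  shows "k1 \<in> Hom C A P" "k2 \<in> Hom C B P"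
    "\<lbrakk>f \<in> Hom C A W; g \<in> Hom C B W\<rbrakk>
      \<Longrightarrow> \<exists>!h. h \<in> Hom C P W \<and> h \<cdot>\<^bsub>C\<^esub> k1 = f \<and> h \<cdot>\<^bsub>C\<^esub> k2 = g"
  using assms unfolding is_coproduct_def by simp_all

lemma is_pullbackD:
  assumes "is_pullback C m n p q" "m \<in> Hom C M X" "n \<in> Hom C N X"
  shows "p \<in> Hom C (Dom C p) M" "q \<in> Hom C (Dom C p) N" "m \<cdot>\<^bsub>C\<^esub> p = n \<cdot>\<^bsub>C\<^esub> q"
    "\<lbrakk>u \<in> Hom C W M; v \<in> Hom C W N; m \<cdot>\<^bsub>C\<^esub> u = n \<cdot>\<^bsub>C\<^esub> v\<rbrakk>
      \<Longrightarrow> \<exists>!w. w \<in> Hom C W (Dom C p) \<and> p \<cdot>\<^bsub>C\<^esub> w = u \<and> q \<cdot>\<^bsub>C\<^esub> w = v"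
  using assms(1) Hom_Dom[OF assms(2)] Hom_Dom[OF assms(3)] unfolding is_pullback_def by blast+


section \<open>Subobjects\<close>

context category
begin

section \<open>Factorisation, zero objects and subobject classes in a category\<close>

lemma Hom_Obj: "f \<in> Hom C A B \<Longrightarrow> A \<in> Obj C" "f \<in> Hom C A B \<Longrightarrow> B \<in> Obj C"
  using Dom_closed Cod_closed by (auto simp: in_Hom_iff)

lemma belowI: "\<lbrakk>f \<in> Hom C A B; b \<in> Hom C B X\<rbrakk> \<Longrightarrow> below C (b \<cdot> f) b"
  using Hom_Dom[OF Comp_closed[of f A B b X]] Hom_Dom[of b C B X] unfolding below_def by metis

lemma belowE:
  assumes "below C a b" "a \<in> Hom C A X" "b \<in> Hom C B Y"
  obtains f where "f \<in> Hom C A B" "a = b \<cdot> f"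
  using assms(1) that unfolding below_def Hom_Dom[OF assms(2)] Hom_Dom[OF assms(3)] by blast

lemma below_refl: "a \<in> Hom C A X \<Longrightarrow> below C a a"
  using belowI[OF Id_closed[of A], of a X] Id_right[of a A X] Hom_Obj by metis

lemma below_trans:
  assumes "below C a b" "below C b c" "a \<in> Hom C A X" "b \<in> Hom C B X" "c \<in> Hom C D X"
  shows "below C a c"
proof -
  obtain f where f: "f \<in> Hom C A B" "a = b \<cdot> f" using assms belowE by metis
  obtain g where g: "g \<in> Hom C B D" "b = c \<cdot> g" using assms belowE by metis
  have "a = c \<cdot> (g \<cdot> f)" using f g Comp_assoc assms(5) by metis
  then show ?thesis using belowI[OF Comp_closed[OF f(1) g(1)] assms(5)] by simp
qed

lemma zero_object_arr:
  assumes "zero_object C Z" "A \<in> Obj C"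
  shows "\<exists>f. f \<in> Hom C A Z" "\<exists>f. f \<in> Hom C Z A"
proof -
  have "(\<exists>!f. f \<in> Hom C A Z) \<and> (\<exists>!f. f \<in> Hom C Z A)"
    using assms unfolding zero_object_def by simp
  then show "\<exists>f. f \<in> Hom C A Z" "\<exists>f. f \<in> Hom C Z A" by (auto dest: ex1_implies_ex)
qed

lemma zero_object_unique:
  assumes "zero_object C Z"
  shows "\<lbrakk>f \<in> Hom C A Z; g \<in> Hom C A Z\<rbrakk> \<Longrightarrow> f = g" "\<lbrakk>f \<in> Hom C Z A; g \<in> Hom C Z A\<rbrakk> \<Longrightarrow> f = g"
  using assms Hom_Obj(1)[of f A Z] Hom_Obj(2)[of f Z A] unfolding zero_object_def by metis+

text \<open>Cancel \<open>a\<close> in \<open>a \<cdot> (g \<cdot> f) = b \<cdot> f = a\<close>.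
  Applied in both directions, this turns mutual factorisation of two monos into an isomorphism of
  their domains.\<close>

lemma mono_arr_mutual_inverse:
  assumes "mono_arr C a" "a \<in> Hom C A X" "f \<in> Hom C A B" "g \<in> Hom C B A" "b \<in> Hom C B X"
    and "a = b \<cdot> f" "b = a \<cdot> g"
  shows "g \<cdot> f = \<one> A"
proof (rule mono_arrD[OF assms(1,2)])
  show "g \<cdot> f \<in> Hom C A A" using assms Comp_closed by metis
  show "\<one> A \<in> Hom C A A" using assms Id_closed Hom_Obj by metis
  show "a \<cdot> (g \<cdot> f) = a \<cdot> \<one> A"
    using assms(6,7)[symmetric] Comp_assoc[OF assms(3,4,2)] Id_right[OF assms(2)] by simp
qed

lemma iso_arrI:
  "\<lbrakk>f \<in> Hom C A B; g \<in> Hom C B A; g \<cdot> f = \<one> A; f \<cdot> g = \<one> B\<rbrakk> \<Longrightarrow> iso_arr C f"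
  unfolding iso_arr_def in_Hom_iff[of f] by blast

lemma iso_arrE:
  assumes "iso_arr C f" "f \<in> Hom C A B"
  obtains g where "g \<in> Hom C B A" "g \<cdot> f = \<one> A" "f \<cdot> g = \<one> B"
  using assms(1) that unfolding iso_arr_def Hom_Dom[OF assms(2)] Hom_Cod[OF assms(2)] by blast

text \<open>For monos, the isomorphism demanded by \<open>subobject_class\<close> can be traded for
  a pair of factorisations, which are automatically inverse to each other. Questions about classes
  thereby become questions about the preorder \<open>below\<close>.\<close>

lemma in_subobject_class_iff:
  assumes "mono_arr C m" "m \<in> Hom C M X"
  shows "n \<in> subobject_class C m \<longleftrightarrow>
    mono_arr C n \<and> Cod C n = X \<and> below C n m \<and> below C m n"
proof
  assume n: "n \<in> subobject_class C m"
  then have "\<exists>i\<in>Hom C (Dom C n) M. iso_arr C i \<and> n = m \<cdot> i"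
    by (simp add: subobject_class_def Hom_Dom[OF assms(2)])
  then obtain i where i: "i \<in> Hom C (Dom C n) M" "iso_arr C i" "n = m \<cdot> i" by metis
  obtain j where j: "j \<in> Hom C M (Dom C n)" "i \<cdot> j = \<one> M" using iso_arrE i by metis
  have nH: "n \<in> Hom C (Dom C n) X" using i assms Comp_closed by metis
  have "m = n \<cdot> j"
    using i(3) j(2) Comp_assoc[OF j(1) i(1) assms(2)] Id_right[OF assms(2)] by simp
  then show "mono_arr C n \<and> Cod C n = X \<and> below C n m \<and> below C m n"
    using n belowI[OF j(1) nH] belowI[OF i(1) assms(2)] i(3) Hom_Cod[OF nH]
    by (simp add: subobject_class_def)
next
  assume n: "mono_arr C n \<and> Cod C n = X \<and> below C n m \<and> below C m n"
  then have nH: "n \<in> Hom C (Dom C n) X" by (auto simp: in_Hom_iff mono_arr_def)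
  obtain f where f: "f \<in> Hom C (Dom C n) M" "n = m \<cdot> f" using n nH assms belowE by metis
  obtain g where g: "g \<in> Hom C M (Dom C n)" "m = n \<cdot> g" using n nH assms belowE by metis
  have "g \<cdot> f = \<one> (Dom C n)" using mono_arr_mutual_inverse n nH f g assms by metis
  moreover have "f \<cdot> g = \<one> M" using mono_arr_mutual_inverse nH f g assms by metis
  ultimately have "iso_arr C f" using iso_arrI f g by metis
  then show "n \<in> subobject_class C m"
    using n f by (auto simp: subobject_class_def Hom_Dom[OF assms(2)] Hom_Cod[OF assms(2)])
qed

lemma subobject_class_eq_iff:
  assumes "mono_arr C a" "a \<in> Hom C A X" "mono_arr C b" "b \<in> Hom C B X"
  shows "subobject_class C a = subobject_class C b \<longleftrightarrow> below C a b \<and> below C b a"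
proof
  assume "subobject_class C a = subobject_class C b"
  then have "a \<in> subobject_class C b"
    using in_subobject_class_iff[OF assms(1,2)] below_refl assms by (auto simp: in_Hom_iff)
  then show "below C a b \<and> below C b a" using in_subobject_class_iff[OF assms(3,4)] by blast
next
  assume ab: "below C a b \<and> below C b a"
  have "below C n a \<and> below C a n \<longleftrightarrow> below C n b \<and> below C b n"
    if "mono_arr C n" "Cod C n = X" for n
  proof -
    have "n \<in> Hom C (Dom C n) X" using that by (auto simp: mono_arr_def in_Hom_iff)
    then show ?thesis using ab assms below_trans by meson
  qed
  then show "subobject_class C a = subobject_class C b"
    using in_subobject_class_iff[OF assms(1,2)] in_subobject_class_iff[OF assms(3,4)] by blast
qed

text \<open>\<open>subobject_le\<close> asks only for some pair of comparable representatives. Every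
  representative factors mutually with the chosen one, so by transitivity the choice does not
  matter.\<close>

lemma subobject_le_class_iff:
  assumes "mono_arr C a" "a \<in> Hom C A X" "mono_arr C b" "b \<in> Hom C B X"
  shows "subobject_le C (subobject_class C a) (subobject_class C b) \<longleftrightarrow> below C a b"
proof
  assume "subobject_le C (subobject_class C a) (subobject_class C b)"
  then obtain m n where mn: "m \<in> subobject_class C a" "n \<in> subobject_class C b" "below C m n"
    unfolding subobject_le_def below_def by blast
  have m: "below C a m" "m \<in> Hom C (Dom C m) X"
    using mn(1) in_subobject_class_iff[OF assms(1,2)] by (auto simp: mono_arr_def in_Hom_iff)
  have n: "below C n b" "n \<in> Hom C (Dom C n) X"
    using mn(2) in_subobject_class_iff[OF assms(3,4)] by (auto simp: mono_arr_def in_Hom_iff)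
  show "below C a b" using below_trans m n mn(3) assms by meson
next
  assume "below C a b"
  moreover have "a \<in> subobject_class C a" "b \<in> subobject_class C b"
    using in_subobject_class_iff[OF assms(1,2)] in_subobject_class_iff[OF assms(3,4)]
      below_refl assms by (auto simp: in_Hom_iff)
  ultimately show "subobject_le C (subobject_class C a) (subobject_class C b)"
    unfolding subobject_le_def below_def by blast
qed

end

context dagger_category
begin

section \<open>Dagger monos\<close>

lemma dagger_mono_iff: "m \<in> Hom C M X \<Longrightarrow> dagger_mono C m \<longleftrightarrow> m\<^sup>\<dagger> \<cdot> m = \<one> M"
  by (auto simp: dagger_mono_def in_Hom_iff)

lemma dagger_mono_mono:
  assumes "dagger_mono C m"
  shows "mono_arr C m"
proof -
  have m: "m \<in> Hom C (Dom C m) (Cod C m)" using assms by (auto simp: dagger_mono_def in_Hom_iff)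
  have "m\<^sup>\<dagger> \<cdot> (m \<cdot> f) = f" if "f \<in> Hom C W (Dom C m)" for W f
    using Comp_assoc[OF that m Dag_closed[OF m]] assms Id_left[OF that]
    unfolding dagger_mono_def by simp
  then show ?thesis using mono_arrI[OF m] by metis
qed

lemma dagger_mono_comp:
  assumes "dagger_mono C m" "dagger_mono C n" "n \<in> Hom C N M" "m \<in> Hom C M X"
  shows "dagger_mono C (m \<cdot> n)"
proof -
  have "(m \<cdot> n)\<^sup>\<dagger> \<cdot> (m \<cdot> n) = n\<^sup>\<dagger> \<cdot> (m\<^sup>\<dagger> \<cdot> m \<cdot> n)"
    using Comp_assoc[OF Comp_closed[OF assms(3,4)] Dag_closed[OF assms(4)] Dag_closed[OF assms(3)]]
      Comp_assoc[OF assms(3,4) Dag_closed[OF assms(4)]] Dag_Comp[OF assms(3,4)] by simp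
  also have "\<dots> = \<one> N"
    using assms dagger_mono_iff[OF assms(3)] dagger_mono_iff[OF assms(4)] Id_left[OF assms(3)] by simp
  finally show ?thesis using dagger_mono_iff assms Comp_closed by metis
qed

end


section \<open>Orthogonality\<close>

context pre_hilbert_category
begin

text \<open>This makes the definite description in \<open>zero_arr\<close> usable. Two zero objects
  are compared along an arrow \<open>w\<close> between them; uniqueness of arrows into and out of
  zero objects forces both triangles to commute, so the two composites agree.\<close>

lemma zero_arr_eq:
  assumes Z: "zero_object C Z" and u: "u \<in> Hom C A Z" and v: "v \<in> Hom C Z B"
  shows "zero_arr C A B = v \<cdot> u"
  unfolding zero_arr_def
proof (rule the_equality)
  show "\<exists>Z u' v'. zero_object C Z \<and> u' \<in> Hom C A Z \<and> v' \<in> Hom C Z B \<and> v \<cdot> u = v' \<cdot> u'"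
    using assms by blast
next
  fix h
  assume "\<exists>Z u v. zero_object C Z \<and> u \<in> Hom C A Z \<and> v \<in> Hom C Z B \<and> h = v \<cdot> u"
  then obtain Z' u' v' where Z': "zero_object C Z'" and u': "u' \<in> Hom C A Z'"
    and v': "v' \<in> Hom C Z' B" and h: "h = v' \<cdot> u'" by blast
  obtain w where w: "w \<in> Hom C Z Z'" using zero_object_arr(2)[OF Z Hom_Obj(1)[OF v']] by blast
  have "v' \<cdot> w = v"
    using zero_object_unique(2)[OF Z Comp_closed[OF w v'] v] .
  moreover have "w \<cdot> u = u'"
    using zero_object_unique(1)[OF Z' Comp_closed[OF u w] u'] .
  ultimately show "h = v \<cdot> u" using h Comp_assoc[OF u w v'] by simp
qed

lemma zero_arr_factor:
  assumes "A \<in> Obj C" "B \<in> Obj C"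
  obtains Z u v where "zero_object C Z" "u \<in> Hom C A Z" "v \<in> Hom C Z B" "zero_arr C A B = v \<cdot> u"
proof -
  obtain Z where Z: "zero_object C Z" using zero_object_exists by blast
  then obtain u v where "u \<in> Hom C A Z" "v \<in> Hom C Z B"
    using zero_object_arr assms by meson
  then show thesis using that Z zero_arr_eq by blast
qed

lemma zero_arr_closed: "\<lbrakk>A \<in> Obj C; B \<in> Obj C\<rbrakk> \<Longrightarrow> zero_arr C A B \<in> Hom C A B"
  by (metis zero_arr_factor Comp_closed)

lemma comp_zero_arr:
  assumes "f \<in> Hom C B D" "A \<in> Obj C"
  shows "f \<cdot> zero_arr C A B = zero_arr C A D"
proof -
  obtain Z u v where z: "zero_object C Z" "u \<in> Hom C A Z" "v \<in> Hom C Z B" "zero_arr C A B = v \<cdot> u"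
    using zero_arr_factor assms Hom_Obj by metis
  then show ?thesis using
    zero_arr_eq[OF z(1,2) Comp_closed[OF z(3) assms(1)]] Comp_assoc[OF z(2,3) assms(1)] by simp
qed

lemma zero_arr_comp:
  assumes "f \<in> Hom C A B" "D \<in> Obj C"
  shows "zero_arr C B D \<cdot> f = zero_arr C A D"
proof -
  obtain Z u v where z: "zero_object C Z" "u \<in> Hom C B Z" "v \<in> Hom C Z D" "zero_arr C B D = v \<cdot> u"
    using zero_arr_factor assms Hom_Obj by metis
  then show ?thesis using
    zero_arr_eq[OF z(1) Comp_closed[OF assms(1) z(2)] z(3)] Comp_assoc[OF assms(1) z(2,3)] by simp
qed

lemma Dag_zero_arr:
  assumes "A \<in> Obj C" "B \<in> Obj C"
  shows "(zero_arr C A B)\<^sup>\<dagger> = zero_arr C B A"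
proof -
  obtain Z u v where z: "zero_object C Z" "u \<in> Hom C A Z" "v \<in> Hom C Z B" "zero_arr C A B = v \<cdot> u"
    using zero_arr_factor assms by metis
  then show ?thesis using zero_arr_eq[OF z(1) Dag_closed[OF z(3)] Dag_closed[OF z(2)]]
    Dag_Comp[OF z(2,3)] by simp
qed

lemma Dag_Dag_Hom: "f \<in> Hom C A B \<Longrightarrow> (f\<^sup>\<dagger>)\<^sup>\<dagger> = f"
  using Dag_Dag by (simp add: in_Hom_iff)

lemma orth_iff:
  "\<lbrakk>a \<in> Hom C A X; b \<in> Hom C B X\<rbrakk> \<Longrightarrow> orth C a b \<longleftrightarrow> a\<^sup>\<dagger> \<cdot> b = zero_arr C B A"
  by (simp add: orth_def in_Hom_iff)

text \<open>Apply the dagger to the defining equation; the dagger of a zero arrow is the zero arrow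
  in the other direction.\<close>

lemma orth_sym:
  assumes "a \<in> Hom C A X" "b \<in> Hom C B X" "orth C a b"
  shows "orth C b a"
proof -
  have "b\<^sup>\<dagger> \<cdot> a = (a\<^sup>\<dagger> \<cdot> b)\<^sup>\<dagger>"
    using Dag_Comp[OF assms(2) Dag_closed[OF assms(1)]] Dag_Dag_Hom[OF assms(1)] by simp
  then show ?thesis
    using assms(3) orth_iff[OF assms(1,2)] orth_iff[OF assms(2,1)]
      Dag_zero_arr[OF Hom_Obj(1)[OF assms(2)] Hom_Obj(1)[OF assms(1)]] by simp
qed

lemma orth_comp:
  assumes "a \<in> Hom C A X" "b \<in> Hom C B X" "orth C a b" "f \<in> Hom C D B"
  shows "orth C a (b \<cdot> f)"
proof -
  have "a\<^sup>\<dagger> \<cdot> (b \<cdot> f) = zero_arr C B A \<cdot> f"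
    using assms(3) Comp_assoc[OF assms(4,2) Dag_closed[OF assms(1)]] orth_iff[OF assms(1,2)] by simp
  then show ?thesis
    using zero_arr_comp[OF assms(4) Hom_Obj(1)[OF assms(1)]]
      orth_iff[OF assms(1) Comp_closed[OF assms(4,2)]] by simp
qed

lemma orth_below:
  assumes "a \<in> Hom C A X" "b \<in> Hom C B X" "c \<in> Hom C D X" "orth C a b" "below C c b"
  shows "orth C a c"
  using assms belowE[OF assms(5,3,2)] orth_comp by metis

text \<open>\<open>a\<^sup>\<dagger> \<cdot> d\<close> and the zero arrow agree after composition
  with \<open>e\<close>. For joins this passes orthogonality from a cotuple to its dagger mono
  part.\<close>

lemma orth_cancel_epi:
  assumes "a \<in> Hom C A X" "d \<in> Hom C D X" "e \<in> Hom C P D" "epi_arr C e" "orth C a (d \<cdot> e)"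
  shows "orth C a d"
proof -
  have "(a\<^sup>\<dagger> \<cdot> d) \<cdot> e = zero_arr C D A \<cdot> e"
    using assms(5) Comp_assoc[OF assms(3,2) Dag_closed[OF assms(1)]]
      orth_iff[OF assms(1) Comp_closed[OF assms(3,2)]]
      zero_arr_comp[OF assms(3) Hom_Obj(1)[OF assms(1)]] by simp
  moreover have "a\<^sup>\<dagger> \<cdot> d \<in> Hom C D A" "zero_arr C D A \<in> Hom C D A"
    using assms Comp_closed Dag_closed zero_arr_closed Hom_Obj by metis+
  ultimately show ?thesis using epi_arrD assms orth_iff by metis
qed

section \<open>Kernels and orthogonal complements of arrows\<close>

lemma is_kernelD:
  assumes "is_kernel C k f"
  shows "k \<in> Hom C (Dom C k) (Dom C f)" "f \<in> Hom C (Cod C k) (Cod C f)"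
    "f \<cdot> k = zero_arr C (Dom C k) (Cod C f)"
proof -
  show k: "k \<in> Hom C (Dom C k) (Dom C f)" and f: "f \<in> Hom C (Cod C k) (Cod C f)"
    using assms unfolding is_kernel_def is_equaliser_def in_Hom_iff by auto
  show "f \<cdot> k = zero_arr C (Dom C k) (Cod C f)"
    using assms zero_arr_comp[OF k] Hom_Obj(2)[OF f]
    unfolding is_kernel_def is_equaliser_def by simp
qed

lemma below_kernel_iff:
  assumes "is_kernel C k f" "f \<in> Hom C X Y" "h \<in> Hom C W X"
  shows "below C h k \<longleftrightarrow> f \<cdot> h = zero_arr C W Y"
proof
  note k = is_kernelD[OF assms(1)]
  have kH: "k \<in> Hom C (Dom C k) X" using k(1) assms(2) by (simp add: in_Hom_iff)
  {
    assume "below C h k"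
    then obtain u where u: "u \<in> Hom C W (Dom C k)" "h = k \<cdot> u" using assms kH belowE by metis
    then have "f \<cdot> h = (f \<cdot> k) \<cdot> u" using Comp_assoc[OF u(1) kH assms(2)] by simp
    then show "f \<cdot> h = zero_arr C W Y"
      using k(3) zero_arr_comp[OF u(1)] assms Hom_Obj by (metis in_Hom_iff)
  next
    assume "f \<cdot> h = zero_arr C W Y"
    also have "\<dots> = zero_arr C X Y \<cdot> h" using zero_arr_comp assms Hom_Obj by metis
    finally have "\<exists>u\<in>Hom C W (Dom C k). k \<cdot> u = h"
      using is_equaliserD(3)[OF assms(1)[unfolded is_kernel_def] assms(2,3)]
        Hom_Dom[OF assms(2)] Hom_Cod[OF assms(2)] by simp
    then show "below C h k" using belowI kH by metis
  }
qed

lemma kernel_exists: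
  assumes "f \<in> Hom C X Y"
  obtains k K where "is_kernel C k f" "dagger_mono C k" "k \<in> Hom C K X"
proof -
  obtain k where "is_equaliser C k f (zero_arr C X Y)" "dagger_mono C k"
    using dagger_equaliser_exists zero_arr_closed assms Hom_Obj by metis
  moreover from this have "is_kernel C k f"
    using assms unfolding is_kernel_def in_Hom_iff by simp
  ultimately show thesis using that is_kernelD assms by (metis in_Hom_iff)
qed

lemma below_perp_iff:
  assumes "is_kernel C k (m\<^sup>\<dagger>)" "m \<in> Hom C M X" "h \<in> Hom C W X"
  shows "below C h k \<longleftrightarrow> orth C m h"
  using below_kernel_iff[OF assms(1) Dag_closed] orth_iff assms by blast

lemma perp_closed_Hom:
  assumes "is_kernel C k (m\<^sup>\<dagger>)" "m \<in> Hom C M X"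
  shows "k \<in> Hom C (Dom C k) X"
  using is_kernelD(1)[OF assms(1)] Dag_closed[OF assms(2)] by (simp add: in_Hom_iff)

lemma orth_perp:
  assumes "is_kernel C k (m\<^sup>\<dagger>)" "m \<in> Hom C M X"
  shows "orth C m k"
  using below_perp_iff[OF assms] perp_closed_Hom[OF assms] below_refl by blast

text \<open>For the converse, write \<open>m\<close> as the kernel of some \<open>t\<close>. The
  single test arrow \<open>t\<^sup>\<dagger>\<close> suffices: it is orthogonal to \<open>m\<close>
  because \<open>t \<cdot> m\<close> is zero, and its orthogonality to \<open>h\<close> says that
  \<open>t \<cdot> h\<close> is zero, so \<open>h\<close> factors through the kernel.\<close>

lemma below_dagger_mono_iff:
  assumes "dagger_mono C m" "m \<in> Hom C M X" "h \<in> Hom C W X"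
  shows "below C h m \<longleftrightarrow> (\<forall>A. \<forall>a\<in>Hom C A X. orth C a m \<longrightarrow> orth C a h)"
proof
  assume "below C h m"
  then show "\<forall>A. \<forall>a\<in>Hom C A X. orth C a m \<longrightarrow> orth C a h" using orth_below assms by blast
next
  assume R: "\<forall>A. \<forall>a\<in>Hom C A X. orth C a m \<longrightarrow> orth C a h"
  obtain t where t: "is_kernel C m t" using dagger_mono_is_kernel assms by blast
  have tH: "t \<in> Hom C X (Cod C t)" using is_kernelD(2)[OF t] assms by (simp add: in_Hom_iff)
  have "t \<cdot> m = zero_arr C M (Cod C t)" using is_kernelD(3)[OF t] assms by (simp add: in_Hom_iff)
  then have "orth C (t\<^sup>\<dagger>) m" using orth_iff[OF Dag_closed[OF tH] assms(2)] Dag_Dag_Hom[OF tH] by simp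
  then have "orth C (t\<^sup>\<dagger>) h" using R Dag_closed[OF tH] by blast
  then have "t \<cdot> h = zero_arr C W (Cod C t)"
    using orth_iff[OF Dag_closed[OF tH] assms(3)] Dag_Dag_Hom[OF tH] by simp
  then show "below C h m" using below_kernel_iff t tH assms by blast
qed

text \<open>One direction is symmetry of orthogonality. For the other, an arrow orthogonal to
  \<open>m\<close> factors through the complement \<open>k\<close>, which is orthogonal to
  \<open>d\<close>; so it is orthogonal to \<open>d\<close> as well, and the test for dagger monos
  applies.\<close>

lemma perp_perp_below:
  assumes "dagger_mono C m" "m \<in> Hom C M X" "is_kernel C k (m\<^sup>\<dagger>)" "is_kernel C d (k\<^sup>\<dagger>)"
  shows "below C d m" "below C m d"
proof -
  have k: "k \<in> Hom C (Dom C k) X" using perp_closed_Hom assms by blast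
  have d: "d \<in> Hom C (Dom C d) X" using perp_closed_Hom assms k by blast
  show "below C m d"
    using below_perp_iff[OF assms(4) k assms(2)] orth_sym[OF assms(2) k orth_perp[OF assms(3,2)]] by blast
  have "orth C a d" if a: "a \<in> Hom C A X" "orth C a m" for A a
  proof -
    have "below C a k" using below_perp_iff[OF assms(3,2) a(1)] orth_sym[OF a(1) assms(2) a(2)] by blast
    then show ?thesis
      using orth_sym[OF d a(1)] orth_below[OF d k a(1)] orth_sym[OF k d orth_perp[OF assms(4) k]] by blast
  qed
  then show "below C d m" using below_dagger_mono_iff assms d by blast
qed

text \<open>If \<open>a = m \<cdot> f\<close>, then \<open>f\<close> is recovered as
  \<open>m\<^sup>\<dagger> \<cdot> a\<close>, which orthogonality makes zero.\<close>

lemma orth_self_zero: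
  assumes "a \<in> Hom C A X" "dagger_mono C m" "m \<in> Hom C M X" "below C a m" "orth C m a"
  shows "a = zero_arr C A X"
proof -
  obtain f where f: "f \<in> Hom C A M" "a = m \<cdot> f" using belowE assms by metis
  have "f = m\<^sup>\<dagger> \<cdot> a"
    using f Comp_assoc[OF f(1) assms(3) Dag_closed[OF assms(3)]] assms(2) dagger_mono_iff[OF assms(3)]
      Id_left[OF f(1)] by simp
  then have "f = zero_arr C A M" using assms(5) orth_iff[OF assms(3,1)] by simp
  then show ?thesis using f(2) comp_zero_arr[OF assms(3) Hom_Obj(1)[OF assms(1)]] by simp
qed

text \<open>
  The \<open>\<dagger>\<close>-mono part is \<open>h\<^sup>\<bottom>\<^sup>\<bottom>\<close>. The other factor \<open>e\<close> is epi: if \<open>e\<close> equalises \<open>f\<close> and \<open>g\<close>, then \<open>h\<close>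
  factors through \<open>d\<close> composed with the equaliser of \<open>f\<close> and \<open>g\<close>, hence so does \<open>h\<^sup>\<bottom>\<^sup>\<bottom> = d\<close>, and
  the equaliser is split epi.
\<close>

lemma epi_dagger_mono_factorisation:
  assumes h: "h \<in> Hom C P X"
  obtains D d e where "e \<in> Hom C P D" "epi_arr C e" "d \<in> Hom C D X" "dagger_mono C d" "h = d \<cdot> e"
proof -
  obtain k K where k: "is_kernel C k (h\<^sup>\<dagger>)" "k \<in> Hom C K X"
    using kernel_exists[OF Dag_closed[OF h]] by metis
  obtain d D where d: "is_kernel C d (k\<^sup>\<dagger>)" "dagger_mono C d" "d \<in> Hom C D X"
    using kernel_exists[OF Dag_closed[OF k(2)]] by metis
  have "below C h d" using below_perp_iff[OF d(1) k(2) h] orth_sym[OF h k(2) orth_perp[OF k(1) h]] by blast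
  then obtain e where e: "e \<in> Hom C P D" "h = d \<cdot> e" using belowE h d(3) by metis
  have "f = g" if f: "f \<in> Hom C D W" and g: "g \<in> Hom C D W" and fg: "f \<cdot> e = g \<cdot> e" for W f g
  proof -
    obtain m where m: "is_equaliser C m f g" "dagger_mono C m"
      using dagger_equaliser_exists f g by blast
    have mH: "m \<in> Hom C (Dom C m) D" and fgm: "f \<cdot> m = g \<cdot> m"
      using is_equaliserD(1,2)[OF m(1) f] by blast+
    obtain e' where e': "e' \<in> Hom C P (Dom C m)" "m \<cdot> e' = e"
      using is_equaliserD(3)[OF m(1) f e(1) fg] by blast
    let ?n = "d \<cdot> m"
    have n: "?n \<in> Hom C (Dom C m) X" "dagger_mono C ?n"
      using dagger_mono_comp mH d m Comp_closed by metis+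
    have hn: "h = ?n \<cdot> e'" using e(2) e'(2) Comp_assoc[OF e'(1) mH d(3)] by simp
    \<comment> \<open>An arrow orthogonal to \<open>?n\<close> is orthogonal to \<open>h\<close>,
      which factors through \<open>?n\<close>. Hence it factors through the complement
      \<open>k\<close> of \<open>h\<close>, and \<open>k\<close> is orthogonal to
      \<open>d\<close>.\<close>
    have "orth C a d" if a: "a \<in> Hom C A X" "orth C a ?n" for A a
    proof -
      have "orth C a h" using orth_comp[OF a(1) n(1) a(2) e'(1)] hn by simp
      then have "below C a k" using below_perp_iff[OF k(1) h a(1)] orth_sym[OF a(1) h] by blast
      then show ?thesis
        using orth_sym[OF d(3) a(1)] orth_below[OF d(3) k(2) a(1)]
          orth_sym[OF k(2) d(3) orth_perp[OF d(1) k(2)]] by blast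
    qed
    then have "below C d ?n" using below_dagger_mono_iff n d by blast
    then obtain r where r: "r \<in> Hom C D (Dom C m)" "d = ?n \<cdot> r" using belowE n d by metis
    have "m \<cdot> r = \<one> D"
    proof (rule mono_arrD[OF dagger_mono_mono[OF d(2)] d(3)])
      show "m \<cdot> r \<in> Hom C D D" using mH r Comp_closed by metis
      show "\<one> D \<in> Hom C D D" using Id_closed Hom_Obj d by metis
      show "d \<cdot> (m \<cdot> r) = d \<cdot> \<one> D"
        using trans[OF Comp_assoc[OF r(1) mH d(3), symmetric] r(2)[symmetric]] Id_right[OF d(3)] by simp
    qed
    then have "f = (f \<cdot> m) \<cdot> r" "(g \<cdot> m) \<cdot> r = g"
      using Comp_assoc[OF r(1) mH f] Comp_assoc[OF r(1) mH g] Id_right[OF f] Id_right[OF g] by simp_all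
    then show "f = g" unfolding fgm by (rule trans)
  qed
  then have "epi_arr C e" using epi_arrI[OF e(1)] by blast
  then show thesis using that e d by blast
qed


section \<open>Meets and joins of closed subobjects\<close>

lemma pullback_below:
  assumes "is_pullback C m n p q" "m \<in> Hom C M X" "n \<in> Hom C N X"
  shows "p \<in> Hom C (Dom C p) M" "below C (m \<cdot> p) m" "below C (m \<cdot> p) n"
    "\<lbrakk>a \<in> Hom C A X; below C a m; below C a n\<rbrakk> \<Longrightarrow> below C a (m \<cdot> p)"
proof -
  note pb = is_pullbackD[OF assms]
  show p: "p \<in> Hom C (Dom C p) M" by (fact pb(1))
  note q = pb(2,3)
  show "below C (m \<cdot> p) m" using belowI p assms by blast
  show "below C (m \<cdot> p) n" using belowI q assms by metis
  assume a: "a \<in> Hom C A X" "below C a m" "below C a n"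
  obtain u where u: "u \<in> Hom C A M" "a = m \<cdot> u" using belowE a assms by metis
  obtain v where v: "v \<in> Hom C A N" "a = n \<cdot> v" using belowE a assms by metis
  obtain w where w: "w \<in> Hom C A (Dom C p)" "p \<cdot> w = u"
    using pb(4)[OF u(1) v(1)] u v by metis
  have "a = (m \<cdot> p) \<cdot> w" using w(2) u(2) Comp_assoc[OF w(1) p assms(2)] by simp
  then show "below C a (m \<cdot> p)" using belowI w Comp_closed p assms by metis
qed

text \<open>Arrows identified by \<open>m \<cdot> p\<close> are identified by \<open>p\<close> and
  by \<open>q\<close>, as \<open>m\<close> and \<open>n\<close> are mono, and therefore agree by
  uniqueness in the pullback. This covers the arbitrary pullbacks allowed in \<open>cl_meet\<close>,
  whose legs may fail to be dagger monos.\<close>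

lemma pullback_mono:
  assumes pb: "is_pullback C m n p q" and m: "m \<in> Hom C M X" and n: "n \<in> Hom C N X"
    and "mono_arr C m" "mono_arr C n"
  shows "mono_arr C (m \<cdot> p)"
proof -
  note pb' = is_pullbackD[OF pb m n]
  show ?thesis
  proof (rule mono_arrI[OF Comp_closed[OF pb'(1) m]])
    fix W f g
    assume f: "f \<in> Hom C W (Dom C p)" and g: "g \<in> Hom C W (Dom C p)" and fg: "(m \<cdot> p) \<cdot> f = (m \<cdot> p) \<cdot> g"
    have "m \<cdot> (p \<cdot> f) = m \<cdot> (p \<cdot> g)"
      using fg Comp_assoc[OF f pb'(1) m] Comp_assoc[OF g pb'(1) m] by simp
    then have p: "p \<cdot> f = p \<cdot> g"
      using mono_arrD[OF assms(4) m Comp_closed[OF f pb'(1)] Comp_closed[OF g pb'(1)]] by blast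
    have "n \<cdot> (q \<cdot> f) = n \<cdot> (q \<cdot> g)"
      using fg pb'(3) Comp_assoc[OF f pb'(2) n] Comp_assoc[OF g pb'(2) n] by simp
    then have q: "q \<cdot> f = q \<cdot> g"
      using mono_arrD[OF assms(5) n Comp_closed[OF f pb'(2)] Comp_closed[OF g pb'(2)]] by blast
    have "m \<cdot> (p \<cdot> f) = n \<cdot> (q \<cdot> f)"
      using pb'(3) Comp_assoc[OF f pb'(1) m] Comp_assoc[OF f pb'(2) n] by simp
    then have "\<exists>!w. w \<in> Hom C W (Dom C p) \<and> p \<cdot> w = p \<cdot> f \<and> q \<cdot> w = q \<cdot> f"
      by (rule pb'(4)[OF Comp_closed[OF f pb'(1)] Comp_closed[OF f pb'(2)]])
    then show "f = g" using p q f g by metis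
  qed
qed

text \<open>If \<open>n\<close> is the kernel of \<open>t\<close>, then its pullback along \<open>m\<close> is the kernel of \<open>t \<cdot> m\<close>.\<close>

lemma pullback_exists:
  assumes m: "dagger_mono C m" "m \<in> Hom C M X" and n: "dagger_mono C n" "n \<in> Hom C N X"
  obtains p q where "is_pullback C m n p q" "dagger_mono C p"
proof -
  obtain t where t: "is_kernel C n t" using dagger_mono_is_kernel n by blast
  define Y where "Y = Cod C t"
  have tH: "t \<in> Hom C X Y" using is_kernelD(2)[OF t] n by (simp add: in_Hom_iff Y_def)
  have tm: "t \<cdot> m \<in> Hom C M Y" using tH m Comp_closed by metis
  obtain p P where p: "is_kernel C p (t \<cdot> m)" "dagger_mono C p" "p \<in> Hom C P M"
    using kernel_exists[OF tm] by metis
  have mp: "m \<cdot> p \<in> Hom C P X" using p m Comp_closed by metis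
  have "(t \<cdot> m) \<cdot> p = zero_arr C P Y"
    using is_kernelD(3)[OF p(1)] p(3) tm by (simp add: in_Hom_iff)
  then have "t \<cdot> (m \<cdot> p) = zero_arr C P Y" using Comp_assoc[OF p(3) m(2) tH] by simp
  then have "below C (m \<cdot> p) n" using below_kernel_iff t tH mp by blast
  then obtain q where q: "q \<in> Hom C P N" "m \<cdot> p = n \<cdot> q" using belowE mp n by metis
  have univ: "\<exists>!w. w \<in> Hom C W P \<and> p \<cdot> w = u \<and> q \<cdot> w = v"
    if u: "u \<in> Hom C W M" and v: "v \<in> Hom C W N" and uv: "m \<cdot> u = n \<cdot> v" for W u v
  proof -
    have "below C (m \<cdot> u) n" using uv belowI[OF v n(2)] by simp
    then have "t \<cdot> (m \<cdot> u) = zero_arr C W Y"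
      using below_kernel_iff t tH Comp_closed[OF u m(2)] by blast
    then have "(t \<cdot> m) \<cdot> u = zero_arr C W Y" using Comp_assoc[OF u m(2) tH] by simp
    then have "below C u p" using below_kernel_iff p tm u by blast
    then obtain w where w: "w \<in> Hom C W P" "u = p \<cdot> w" using belowE u p by metis
    have "n \<cdot> (q \<cdot> w) = n \<cdot> v"
      using w(2) uv q(2) Comp_assoc[OF w(1) q(1) n(2)] Comp_assoc[OF w(1) p(3) m(2)] by simp
    then have "q \<cdot> w = v"
      using mono_arrD[OF dagger_mono_mono[OF n(1)] n(2)] Comp_closed[OF w(1) q(1)] v by blast
    moreover have "w' = w" if "w' \<in> Hom C W P" "p \<cdot> w' = u" for w'
      using mono_arrD[OF dagger_mono_mono[OF p(2)] p(3)] that w by blast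
    ultimately show ?thesis using w by blast
  qed
  have "is_pullback C m n p q"
    using m n p q univ Hom_Dom[OF m(2)] Hom_Dom[OF n(2)] Hom_Dom[OF p(3)]
    unfolding is_pullback_def in_Hom_iff[of m] in_Hom_iff[of n] by simp
  then show thesis using that p by blast
qed

text \<open>The part of the description in \<open>cl_join\<close> that concerns fixed
  representatives, split off so that existence and minimality can be proved for arrows before
  passing to classes.\<close>

definition join_image :: "'b \<Rightarrow> 'b \<Rightarrow> 'b \<Rightarrow> bool" where
  "join_image m n d \<longleftrightarrow> (\<exists>P p1 p2 k1 k2 h e.
    is_dagger_biproduct C (Dom C m) (Dom C n) P p1 p2 k1 k2 \<and>
    h \<in> Hom C P (Cod C m) \<and> h \<cdot> k1 = m \<and> h \<cdot> k2 = n \<and>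
    epi_arr C e \<and> dagger_mono C d \<and> Dom C e = P \<and> Cod C e = Dom C d \<and> h = d \<cdot> e)"

lemma join_image_exists:
  assumes m: "m \<in> Hom C M X" and n: "n \<in> Hom C N X"
  obtains d where "join_image m n d"
proof -
  obtain P p1 p2 k1 k2 where b: "is_dagger_biproduct C M N P p1 p2 k1 k2"
    using dagger_biproduct_exists Hom_Obj(1)[OF m] Hom_Obj(1)[OF n] by blast
  then have "is_coproduct C M N P k1 k2" unfolding is_dagger_biproduct_def is_biproduct_def by simp
  then obtain h where h: "h \<in> Hom C P X" "h \<cdot> k1 = m" "h \<cdot> k2 = n"
    using ex1_implies_ex[OF is_coproductD(3)[OF _ m n]] by blast
  obtain D d e where e: "e \<in> Hom C P D" "epi_arr C e" "d \<in> Hom C D X" "dagger_mono C d" "h = d \<cdot> e"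
    using epi_dagger_mono_factorisation[OF h(1)] by metis
  have "Cod C e = Dom C d" using Hom_Cod[OF e(1)] Hom_Dom[OF e(3)] by simp
  then have "join_image m n d"
    unfolding join_image_def Hom_Dom[OF m] Hom_Dom[OF n] Hom_Cod[OF m]
    by (intro exI conjI) (rule b h e Hom_Dom[OF e(1)] | assumption)+
  then show thesis using that by blast
qed

text \<open>For minimality, let \<open>a\<close> be orthogonal to an upper bound \<open>b\<close>.
  Then \<open>a\<close> is orthogonal to \<open>m\<close> and \<open>n\<close>, so
  \<open>a\<^sup>\<dagger> \<cdot> h\<close> vanishes on both injections and is zero by uniqueness
  of cotuples. Cancelling the epi \<open>e\<close> makes \<open>a\<close> orthogonal to
  \<open>d\<close>, and the test for dagger monos yields the factorisation of \<open>d\<close>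
  through \<open>b\<close>.\<close>

lemma join_image_below:
  assumes "join_image m n d" and m: "m \<in> Hom C M X" and n: "n \<in> Hom C N X"
  shows "dagger_mono C d" "d \<in> Hom C (Dom C d) X" "below C m d" "below C n d"
    "\<lbrakk>dagger_mono C b; b \<in> Hom C B X; below C m b; below C n b\<rbrakk> \<Longrightarrow> below C d b"
proof -
  obtain P p1 p2 k1 k2 h e where b: "is_dagger_biproduct C M N P p1 p2 k1 k2"
    and h: "h \<in> Hom C P X" "h \<cdot> k1 = m" "h \<cdot> k2 = n"
    and e: "epi_arr C e" "Dom C e = P" "Cod C e = Dom C d" "h = d \<cdot> e" and d: "dagger_mono C d"
    using assms unfolding join_image_def in_Hom_iff by auto
  show "dagger_mono C d" by (fact d)
  have co: "is_coproduct C M N P k1 k2"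
    using b unfolding is_dagger_biproduct_def is_biproduct_def by simp
  note k = is_coproductD(1,2)[OF co]
  have eH: "e \<in> Hom C P (Dom C d)" using e by (auto simp: in_Hom_iff epi_arr_def)
  \<comment> \<open>The codomain of \<open>d\<close> is not part of \<open>join_image\<close>; it is
    read off from \<open>h = d \<cdot> e\<close>.\<close>
  have "d \<in> Hom C (Dom C d) (Cod C d)" using d by (auto simp: in_Hom_iff dagger_mono_def)
  then have "h \<in> Hom C P (Cod C d)" using Comp_closed[OF eH] e(4) by blast
  then show dH: "d \<in> Hom C (Dom C d) X" using h d by (auto simp: in_Hom_iff dagger_mono_def)
  have "m = d \<cdot> (e \<cdot> k1)" "n = d \<cdot> (e \<cdot> k2)"
    using h(2,3) e(4) Comp_assoc[OF k(1) eH dH] Comp_assoc[OF k(2) eH dH] by simp_all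
  then show "below C m d" "below C n d"
    using belowI[OF Comp_closed[OF k(1) eH] dH] belowI[OF Comp_closed[OF k(2) eH] dH] by simp_all
  assume B: "dagger_mono C b" "b \<in> Hom C B X" "below C m b" "below C n b"
  have "orth C a d" if a: "a \<in> Hom C A X" "orth C a b" for A a
  proof -
    have "a\<^sup>\<dagger> \<cdot> h = zero_arr C P A"
    proof -
      have "orth C a m" "orth C a n"
        using orth_below[OF a(1) B(2) m a(2) B(3)] orth_below[OF a(1) B(2) n a(2) B(4)] by simp_all
      then have "a\<^sup>\<dagger> \<cdot> m = zero_arr C M A" "a\<^sup>\<dagger> \<cdot> n = zero_arr C N A"
        using orth_iff[OF a(1) m] orth_iff[OF a(1) n] by simp_all
      then have "(a\<^sup>\<dagger> \<cdot> h) \<cdot> k1 = zero_arr C M A" "(a\<^sup>\<dagger> \<cdot> h) \<cdot> k2 = zero_arr C N A"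
        using h(2,3) Comp_assoc[OF k(1) h(1) Dag_closed[OF a(1)]]
          Comp_assoc[OF k(2) h(1) Dag_closed[OF a(1)]] by simp_all
      moreover have "zero_arr C P A \<cdot> k1 = zero_arr C M A" "zero_arr C P A \<cdot> k2 = zero_arr C N A"
        using zero_arr_comp k Hom_Obj a by metis+
      moreover have "a\<^sup>\<dagger> \<cdot> h \<in> Hom C P A" "zero_arr C P A \<in> Hom C P A"
        using Comp_closed Dag_closed a h zero_arr_closed Hom_Obj by metis+
      moreover have "zero_arr C M A \<in> Hom C M A" "zero_arr C N A \<in> Hom C N A"
        using zero_arr_closed m n a Hom_Obj by metis+
      ultimately show ?thesis using is_coproductD(3)[OF co] by metis
    qed
    then have "orth C a (d \<cdot> e)" using orth_iff[OF a(1) h(1)] e(4) by simp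
    then show ?thesis using orth_cancel_epi[OF a(1) dH eH e(1)] by blast
  qed
  then show "below C d b" using below_dagger_mono_iff B dH by blast
qed

section \<open>The partial order of closed subobjects\<close>

lemma ClSub_simps:
  "le (ClSub C X) = subobject_le C" "eq (ClSub C X) = (=)"
  by (simp_all add: ClSub_def)

lemma subobject_class_in_ClSub:
  assumes "dagger_mono C m" "m \<in> Hom C M X"
  shows "subobject_class C m \<in> carrier (ClSub C X)"
proof -
  have "m \<in> subobject_class C m"
    using in_subobject_class_iff[OF dagger_mono_mono[OF assms(1)] assms(2)]
      below_refl dagger_mono_mono assms by (auto simp: in_Hom_iff)
  then show ?thesis
    using assms dagger_mono_mono unfolding ClSub_def subobjects_def in_Hom_iff by auto
qed

text \<open>Membership in the carrier presents \<open>S\<close> as the class of some mono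
  \<open>a\<close>, not necessarily a dagger mono. Any member \<open>m\<close> factors mutually with
  \<open>a\<close> and so generates the same class.\<close>

lemma ClSub_representative:
  assumes "S \<in> carrier (ClSub C X)" "m \<in> S" "dagger_mono C m"
  shows "S = subobject_class C m" "m \<in> Hom C (Dom C m) X"
proof -
  obtain a where a: "S = subobject_class C a" "mono_arr C a" "a \<in> Hom C (Dom C a) X"
    using assms unfolding ClSub_def subobjects_def in_Hom_iff mono_arr_def by auto
  have m: "mono_arr C m" "Cod C m = X" "below C m a" "below C a m"
    using in_subobject_class_iff[OF a(2,3)] a(1) assms(2) by blast+
  then show mH: "m \<in> Hom C (Dom C m) X" by (auto simp: in_Hom_iff mono_arr_def)
  show "S = subobject_class C m" using subobject_class_eq_iff[OF a(2,3) m(1) mH] m a(1) by blast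
qed

lemma ClSub_cases:
  assumes "S \<in> carrier (ClSub C X)"
  obtains m M where "S = subobject_class C m" "m \<in> S" "dagger_mono C m" "m \<in> Hom C M X"
proof -
  obtain m where "m \<in> S" "dagger_mono C m" using assms unfolding ClSub_def by auto
  then show thesis using that ClSub_representative[OF assms] by blast
qed

lemma ClSub_le_iff:
  assumes "dagger_mono C a" "a \<in> Hom C A X" "dagger_mono C b" "b \<in> Hom C B X"
  shows "subobject_class C a \<sqsubseteq>\<^bsub>ClSub C X\<^esub> subobject_class C b \<longleftrightarrow> below C a b"
  using subobject_le_class_iff assms dagger_mono_mono by (simp add: ClSub_simps)

lemma ClSub_partial_order: "partial_order (ClSub C X)"
proof
  fix x assume "x \<in> carrier (ClSub C X)"
  then show "x \<sqsubseteq>\<^bsub>ClSub C X\<^esub> x" by (metis ClSub_cases ClSub_le_iff below_refl)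
next
  fix x y assume le: "x \<sqsubseteq>\<^bsub>ClSub C X\<^esub> y" "y \<sqsubseteq>\<^bsub>ClSub C X\<^esub> x"
    and "x \<in> carrier (ClSub C X)" "y \<in> carrier (ClSub C X)"
  then obtain a A b B where a: "x = subobject_class C a" "dagger_mono C a" "a \<in> Hom C A X"
    and b: "y = subobject_class C b" "dagger_mono C b" "b \<in> Hom C B X" by (metis ClSub_cases)
  then have "below C a b" "below C b a" using le ClSub_le_iff by blast+
  then show "x .=\<^bsub>ClSub C X\<^esub> y"
    using a b subobject_class_eq_iff dagger_mono_mono by (simp add: ClSub_simps)
next
  fix x y z assume le: "x \<sqsubseteq>\<^bsub>ClSub C X\<^esub> y" "y \<sqsubseteq>\<^bsub>ClSub C X\<^esub> z"
    and "x \<in> carrier (ClSub C X)" "y \<in> carrier (ClSub C X)" "z \<in> carrier (ClSub C X)"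
  then obtain a A b B d D where a: "x = subobject_class C a" "dagger_mono C a" "a \<in> Hom C A X"
    and b: "y = subobject_class C b" "dagger_mono C b" "b \<in> Hom C B X"
    and d: "z = subobject_class C d" "dagger_mono C d" "d \<in> Hom C D X" by (metis ClSub_cases)
  then have "below C a b" "below C b d" using le ClSub_le_iff by blast+
  then show "x \<sqsubseteq>\<^bsub>ClSub C X\<^esub> z" using a b d ClSub_le_iff below_trans by metis
qed (auto simp: ClSub_simps)

text \<open>Every subobject that fits the description in \<open>cl_meet\<close> is a greatest lower
  bound, and at least one exists. Greatest lower bounds in a partial order are unique, so the
  definite description denotes one.\<close>

lemma cl_meet_greatest:
  assumes S: "S \<in> carrier (ClSub C X)" and T: "T \<in> carrier (ClSub C X)"
  shows "greatest (ClSub C X) (cl_meet C S T) (Lower (ClSub C X) {S, T})"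
proof -
  interpret partial_order "ClSub C X" by (rule ClSub_partial_order)
  define Q where "Q U \<longleftrightarrow> (\<exists>m n p q. m \<in> S \<and> dagger_mono C m \<and> n \<in> T \<and> dagger_mono C n \<and>
    is_pullback C m n p q \<and> U = subobject_class C (m \<cdot> p))" for U
  have G: "greatest (ClSub C X) U (Lower (ClSub C X) {S, T})" if QU: "Q U" for U
  proof -
    obtain m n p q where m: "m \<in> S" "dagger_mono C m" and n: "n \<in> T" "dagger_mono C n"
      and pb: "is_pullback C m n p q" and U: "U = subobject_class C (m \<cdot> p)"
      using QU unfolding Q_def by blast
    note m' = ClSub_representative[OF S m] and n' = ClSub_representative[OF T n]
    note mp = pullback_below[OF pb m'(2) n'(2)]
    \<comment> \<open>The given \<open>p\<close> need not be a dagger mono. It is compared with a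
      pullback whose leg is one: both composites are greatest among the common lower bounds, so they
      represent the same subobject, which is therefore closed.\<close>
    obtain p' q' where pb': "is_pullback C m n p' q'" "dagger_mono C p'"
      using pullback_exists m m' n n' by metis
    note mp' = pullback_below[OF pb'(1) m'(2) n'(2)]
    let ?a = "m \<cdot> p'"
    have a: "dagger_mono C ?a" "?a \<in> Hom C (Dom C p') X"
      using dagger_mono_comp m m' pb' mp' Comp_closed by metis+
    have b: "m \<cdot> p \<in> Hom C (Dom C p) X" using mp m' Comp_closed by metis
    have "mono_arr C (m \<cdot> p)"
      using pullback_mono[OF pb m'(2) n'(2)] dagger_mono_mono m(2) n(2) by blast
    moreover have "below C ?a (m \<cdot> p)" "below C (m \<cdot> p) ?a" using mp(4) mp'(2,3) mp'(4) mp(2,3) a b by blast+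
    ultimately have U': "U = subobject_class C ?a"
      using subobject_class_eq_iff U a b dagger_mono_mono by metis
    have "U \<sqsubseteq>\<^bsub>ClSub C X\<^esub> S" "U \<sqsubseteq>\<^bsub>ClSub C X\<^esub> T"
      using ClSub_le_iff[OF a m(2) m'(2)] ClSub_le_iff[OF a n(2) n'(2)] mp'(2,3) U' m' n' by simp_all
    moreover have "y \<sqsubseteq>\<^bsub>ClSub C X\<^esub> U"
      if y: "y \<in> carrier (ClSub C X)" "y \<sqsubseteq>\<^bsub>ClSub C X\<^esub> S" "y \<sqsubseteq>\<^bsub>ClSub C X\<^esub> T" for y
    proof -
      obtain b B where b: "y = subobject_class C b" "dagger_mono C b" "b \<in> Hom C B X"
        using y ClSub_cases by metis
      have "below C b m" "below C b n"
        using y ClSub_le_iff[OF b(2,3) m(2) m'(2)] ClSub_le_iff[OF b(2,3) n(2) n'(2)] b(1) m'(1) n'(1) by simp_all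
      then show ?thesis using mp'(4) ClSub_le_iff[OF b(2,3) a] b U' by simp
    qed
    moreover have "U \<in> carrier (ClSub C X)" using subobject_class_in_ClSub a U' by blast
    ultimately show ?thesis by (intro greatest_Lower_pairI[OF S T])
  qed
  obtain m M where m: "m \<in> S" "dagger_mono C m" "m \<in> Hom C M X" using S ClSub_cases by metis
  obtain n N where n: "n \<in> T" "dagger_mono C n" "n \<in> Hom C N X" using T ClSub_cases by metis
  have "\<exists>U. Q U" using pullback_exists[OF m(2,3) n(2,3)] m n unfolding Q_def by metis
  moreover have "cl_meet C S T = (THE U. Q U)" unfolding cl_meet_def Q_def by simp
  ultimately show ?thesis using G greatest_unique by (metis the_equality)
qed

text \<open>As for meets: all candidates are least upper bounds, hence equal, and the factorisation
  of the cotuple supplies one.\<close>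

lemma cl_join_least:
  assumes S: "S \<in> carrier (ClSub C X)" and T: "T \<in> carrier (ClSub C X)"
  shows "least (ClSub C X) (cl_join C S T) (Upper (ClSub C X) {S, T})"
proof -
  interpret partial_order "ClSub C X" by (rule ClSub_partial_order)
  define Q where "Q U \<longleftrightarrow> (\<exists>m n d. m \<in> S \<and> dagger_mono C m \<and> n \<in> T \<and> dagger_mono C n \<and>
    join_image m n d \<and> U = subobject_class C d)" for U
  have L: "least (ClSub C X) U (Upper (ClSub C X) {S, T})" if QU: "Q U" for U
  proof -
    obtain m n d where m: "m \<in> S" "dagger_mono C m" and n: "n \<in> T" "dagger_mono C n"
      and d: "join_image m n d" and U: "U = subobject_class C d"
      using QU unfolding Q_def by blast
    note m' = ClSub_representative[OF S m] and n' = ClSub_representative[OF T n]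
    note d' = join_image_below[OF d m'(2) n'(2)]
    have "S \<sqsubseteq>\<^bsub>ClSub C X\<^esub> U" "T \<sqsubseteq>\<^bsub>ClSub C X\<^esub> U"
      using ClSub_le_iff[OF m(2) m'(2) d'(1,2)] ClSub_le_iff[OF n(2) n'(2) d'(1,2)] d'(3,4) U m' n'
      by simp_all
    moreover have "U \<sqsubseteq>\<^bsub>ClSub C X\<^esub> y"
      if y: "y \<in> carrier (ClSub C X)" "S \<sqsubseteq>\<^bsub>ClSub C X\<^esub> y" "T \<sqsubseteq>\<^bsub>ClSub C X\<^esub> y" for y
    proof -
      obtain b B where b: "y = subobject_class C b" "dagger_mono C b" "b \<in> Hom C B X"
        using y ClSub_cases by metis
      have "below C m b" "below C n b"
        using y ClSub_le_iff[OF m(2) m'(2) b(2,3)] ClSub_le_iff[OF n(2) n'(2) b(2,3)] b(1) m'(1) n'(1)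
        by simp_all
      then show ?thesis using d'(5) ClSub_le_iff[OF d'(1,2) b(2,3)] b U by simp
    qed
    moreover have "U \<in> carrier (ClSub C X)" using subobject_class_in_ClSub d' U by blast
    ultimately show ?thesis by (intro least_Upper_pairI[OF S T])
  qed
  obtain m M where m: "m \<in> S" "dagger_mono C m" "m \<in> Hom C M X" using S ClSub_cases by metis
  obtain n N where n: "n \<in> T" "dagger_mono C n" "n \<in> Hom C N X" using T ClSub_cases by metis
  have "\<exists>U. Q U" using join_image_exists[OF m(3) n(3)] m n unfolding Q_def by metis
  moreover have "cl_join C S T = (THE U. Q U)"
    unfolding cl_join_def Q_def join_image_def by (rule arg_cong[where f = The]) blast
  ultimately show ?thesis using L least_unique by (metis the_equality)
qed

text \<open>The bottom is represented by an arrow \<open>z\<close> out of a zero object; it is a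
  dagger mono because \<open>z\<^sup>\<dagger> \<cdot> z\<close> is an endomorphism of that object
  and so the identity. The top is represented by the identity of \<open>X\<close>.\<close>

lemma ClSub_bounded_lattice:
  assumes "X \<in> Obj C"
  shows "bounded_lattice (ClSub C X)"
proof -
  interpret partial_order "ClSub C X" by (rule ClSub_partial_order)
  obtain Z where Z: "zero_object C Z" using zero_object_exists by blast
  obtain z where z: "z \<in> Hom C Z X" using zero_object_arr(2)[OF Z assms] by blast
  have "z\<^sup>\<dagger> \<cdot> z \<in> Hom C Z Z" "\<one> Z \<in> Hom C Z Z"
    using Comp_closed Dag_closed z Id_closed Hom_Obj by metis+
  then have "z\<^sup>\<dagger> \<cdot> z = \<one> Z" using zero_object_unique(1)[OF Z] by blast
  then have zd: "dagger_mono C z" using dagger_mono_iff z by blast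
  have "below C z a" if a: "a \<in> Hom C A X" for a A
  proof -
    obtain u where u: "u \<in> Hom C Z A" using zero_object_arr(2)[OF Z Hom_Obj(1)[OF a]] by blast
    have "a \<cdot> u = z" using zero_object_unique(2)[OF Z Comp_closed[OF u a] z] .
    then show ?thesis using belowI[OF u a] by simp
  qed
  then have "subobject_class C z \<sqsubseteq>\<^bsub>ClSub C X\<^esub> x" if "x \<in> carrier (ClSub C X)" for x
    using that by (metis ClSub_cases ClSub_le_iff zd z)
  then have bot: "least (ClSub C X) (subobject_class C z) (carrier (ClSub C X))"
    using subobject_class_in_ClSub zd z by (auto simp: least_def)
  have i: "\<one> X \<in> Hom C X X" using Id_closed assms by blast
  then have id: "dagger_mono C (\<one> X)" using dagger_mono_iff Dag_Id Id_left assms by metis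
  have "below C a (\<one> X)" if "a \<in> Hom C A X" for a A
    using belowI[OF that i] Id_left that by simp
  then have "x \<sqsubseteq>\<^bsub>ClSub C X\<^esub> subobject_class C (\<one> X)" if "x \<in> carrier (ClSub C X)" for x
    using that by (metis ClSub_cases ClSub_le_iff id i)
  then have top: "greatest (ClSub C X) (subobject_class C (\<one> X)) (carrier (ClSub C X))"
    using subobject_class_in_ClSub id i by (auto simp: greatest_def)
  show ?thesis
  proof
    show "\<exists>x. least (ClSub C X) x (carrier (ClSub C X))" using bot by (rule exI)
    show "\<exists>x. greatest (ClSub C X) x (carrier (ClSub C X))" using top by (rule exI)
    fix x y assume xy: "x \<in> carrier (ClSub C X)" "y \<in> carrier (ClSub C X)"
    show "\<exists>s. least (ClSub C X) s (Upper (ClSub C X) {x, y})" using cl_join_least[OF xy] by (rule exI)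
    show "\<exists>s. greatest (ClSub C X) s (Lower (ClSub C X) {x, y})" using cl_meet_greatest[OF xy] by (rule exI)
  qed
qed

section \<open>The orthocomplement of closed subobjects\<close>

lemma cl_perp_eq:
  assumes "dagger_mono C m" "m \<in> Hom C M X"
  obtains k K where "is_kernel C k (m\<^sup>\<dagger>)" "dagger_mono C k" "k \<in> Hom C K X"
    "cl_perp C (subobject_class C m) = subobject_class C k"
proof -
  obtain k K where k: "is_kernel C k (m\<^sup>\<dagger>)" "dagger_mono C k" "k \<in> Hom C K X"
    using kernel_exists[OF Dag_closed[OF assms(2)]] by metis
  have S: "subobject_class C m \<in> carrier (ClSub C X)" using subobject_class_in_ClSub assms by blast
  have "cl_perp C (subobject_class C m) = subobject_class C k"
    unfolding cl_perp_def
  proof (rule the_equality)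
    have "m \<in> subobject_class C m"
      using in_subobject_class_iff[OF dagger_mono_mono[OF assms(1)] assms(2)]
        below_refl dagger_mono_mono assms by (auto simp: in_Hom_iff)
    then show "\<exists>m' k'. m' \<in> subobject_class C m \<and> dagger_mono C m' \<and> is_kernel C k' (m'\<^sup>\<dagger>) \<and>
        dagger_mono C k' \<and> subobject_class C k = subobject_class C k'" using assms k by blast
  next
    fix U assume "\<exists>m' k'. m' \<in> subobject_class C m \<and> dagger_mono C m' \<and> is_kernel C k' (m'\<^sup>\<dagger>) \<and>
        dagger_mono C k' \<and> U = subobject_class C k'"
    then obtain m' k' where m': "m' \<in> subobject_class C m" "dagger_mono C m'"
      and k': "is_kernel C k' (m'\<^sup>\<dagger>)" "dagger_mono C k'" and U: "U = subobject_class C k'" by blast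
    note m'H = ClSub_representative(2)[OF S m']
    note k'H = perp_closed_Hom[OF k'(1) m'H]
    have mm: "below C m' m" "below C m m'"
      using in_subobject_class_iff[OF dagger_mono_mono[OF assms(1)] assms(2)] m' by blast+
    \<comment> \<open>Representatives that factor through each other are orthogonal to the same
      arrows, and these are exactly the arrows factoring through the respective kernels.\<close>
    have "orth C m h \<longleftrightarrow> orth C m' h" if "h \<in> Hom C W X" for W h
      using orth_sym[OF that assms(2)] orth_sym[OF assms(2) that] orth_sym[OF that m'H] orth_sym[OF m'H that]
        orth_below[OF that assms(2) m'H _ mm(1)] orth_below[OF that m'H assms(2) _ mm(2)] by blast
    then have "below C k k'" "below C k' k"
      using below_perp_iff[OF k(1) assms(2)] below_perp_iff[OF k'(1) m'H]
        orth_perp[OF k(1) assms(2)] orth_perp[OF k'(1) m'H] k(3) k'H by blast+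
    then show "U = subobject_class C k"
      using U subobject_class_eq_iff[OF dagger_mono_mono[OF k(2)] k(3) dagger_mono_mono[OF k'(2)] k'H] by blast
  qed
  then show thesis using that k by blast
qed

lemma cl_perp_closed: "S \<in> carrier (ClSub C X) \<Longrightarrow> cl_perp C S \<in> carrier (ClSub C X)"
  by (metis ClSub_cases cl_perp_eq subobject_class_in_ClSub)

lemma cl_perp_perp:
  assumes "S \<in> carrier (ClSub C X)"
  shows "cl_perp C (cl_perp C S) = S"
proof -
  obtain m M where m: "S = subobject_class C m" "dagger_mono C m" "m \<in> Hom C M X"
    using assms ClSub_cases by metis
  obtain k K where k: "is_kernel C k (m\<^sup>\<dagger>)" "dagger_mono C k" "k \<in> Hom C K X"
    "cl_perp C S = subobject_class C k" using m cl_perp_eq by metis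
  obtain d D where d: "is_kernel C d (k\<^sup>\<dagger>)" "dagger_mono C d" "d \<in> Hom C D X"
    "cl_perp C (subobject_class C k) = subobject_class C d" using k cl_perp_eq by metis
  show ?thesis
    using perp_perp_below[OF m(2,3) k(1) d(1)] m k d subobject_class_eq_iff dagger_mono_mono by metis
qed

lemma ClSub_le_perp_iff:
  assumes "dagger_mono C a" "a \<in> Hom C A X" "dagger_mono C m" "m \<in> Hom C M X"
  shows "subobject_class C a \<sqsubseteq>\<^bsub>ClSub C X\<^esub> cl_perp C (subobject_class C m) \<longleftrightarrow> orth C m a"
proof -
  obtain k K where k: "is_kernel C k (m\<^sup>\<dagger>)" "dagger_mono C k" "k \<in> Hom C K X"
    "cl_perp C (subobject_class C m) = subobject_class C k" using assms cl_perp_eq by metis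
  then show ?thesis using ClSub_le_iff[OF assms(1,2) k(2,3)] below_perp_iff[OF k(1)] assms by simp
qed

text \<open>The complement of the larger subobject is orthogonal to \<open>n\<close>, hence also to
  \<open>m\<close>, which factors through \<open>n\<close>.\<close>

lemma cl_perp_antimono:
  assumes "S \<in> carrier (ClSub C X)" "T \<in> carrier (ClSub C X)" "S \<sqsubseteq>\<^bsub>ClSub C X\<^esub> T"
  shows "cl_perp C T \<sqsubseteq>\<^bsub>ClSub C X\<^esub> cl_perp C S"
proof -
  obtain m M where m: "S = subobject_class C m" "dagger_mono C m" "m \<in> Hom C M X"
    using assms ClSub_cases by metis
  obtain n N where n: "T = subobject_class C n" "dagger_mono C n" "n \<in> Hom C N X"
    using assms ClSub_cases by metis
  obtain k K where k: "is_kernel C k (n\<^sup>\<dagger>)" "dagger_mono C k" "k \<in> Hom C K X"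
    "cl_perp C T = subobject_class C k" using n cl_perp_eq by metis
  have "below C m n" using assms m n ClSub_le_iff by blast
  then have "orth C m k"
    using orth_sym[OF k(3) m(3) orth_below[OF k(3) n(3) m(3) orth_sym[OF n(3) k(3) orth_perp[OF k(1) n(3)]]]]
    by blast
  then show ?thesis using ClSub_le_perp_iff m k by simp
qed

section \<open>Complementation and the orthomodular law\<close>

lemma below_and_perp_bottom:
  assumes X: "X \<in> Obj C" and S: "S \<in> carrier (ClSub C X)" and T: "T \<in> carrier (ClSub C X)"
    and le: "T \<sqsubseteq>\<^bsub>ClSub C X\<^esub> S" "T \<sqsubseteq>\<^bsub>ClSub C X\<^esub> cl_perp C S"
  shows "T = \<bottom>\<^bsub>ClSub C X\<^esub>"
proof -
  interpret bounded_lattice "ClSub C X" using ClSub_bounded_lattice X by blast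
  obtain m M where m: "S = subobject_class C m" "dagger_mono C m" "m \<in> Hom C M X"
    using S ClSub_cases by metis
  obtain a A where a: "T = subobject_class C a" "dagger_mono C a" "a \<in> Hom C A X"
    using T ClSub_cases by metis
  have "below C a m" "orth C m a" using le ClSub_le_iff ClSub_le_perp_iff m a by blast+
  then have az: "a = zero_arr C A X" using orth_self_zero a m by blast
  \<comment> \<open>A subobject represented by a zero arrow is least, since a zero arrow factors
    through every arrow into \<open>X\<close>.\<close>
  have "T \<sqsubseteq>\<^bsub>ClSub C X\<^esub> y" if y: "y \<in> carrier (ClSub C X)" for y
  proof -
    obtain b B where b: "y = subobject_class C b" "dagger_mono C b" "b \<in> Hom C B X"
      using y ClSub_cases by metis
    have "a = b \<cdot> zero_arr C A B" using az comp_zero_arr b a Hom_Obj by metis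
    then have "below C a b" using belowI zero_arr_closed Hom_Obj a b by metis
    then show ?thesis using a b ClSub_le_iff by blast
  qed
  then have "T \<sqsubseteq>\<^bsub>ClSub C X\<^esub> \<bottom>\<^bsub>ClSub C X\<^esub>" by simp
  then show ?thesis using le_antisym T by simp
qed

text \<open>This criterion for equality serves twice: for the join of an element with its
  complement, where \<open>T\<close> is the top, and for the orthomodular law.\<close>

lemma below_eqI:
  assumes X: "X \<in> Obj C" and S: "S \<in> carrier (ClSub C X)" and T: "T \<in> carrier (ClSub C X)"
    and le: "S \<sqsubseteq>\<^bsub>ClSub C X\<^esub> T" and triv: "T \<sqinter>\<^bsub>ClSub C X\<^esub> cl_perp C S = \<bottom>\<^bsub>ClSub C X\<^esub>"
  shows "S = T"
proof -
  interpret bounded_lattice "ClSub C X" using ClSub_bounded_lattice X by blast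
  obtain j J where j: "S = subobject_class C j" "dagger_mono C j" "j \<in> Hom C J X"
    using S ClSub_cases by metis
  obtain n N where n: "T = subobject_class C n" "dagger_mono C n" "n \<in> Hom C N X"
    using T ClSub_cases by metis
  have "below C j n" using le j n ClSub_le_iff by blast
  then obtain w where w: "w \<in> Hom C J N" "j = n \<cdot> w" using belowE j n by metis
  note nd = Dag_closed[OF n(3)] and wd = Dag_closed[OF w(1)] and jd = Dag_closed[OF j(3)]
  \<comment> \<open>Inserting \<open>n\<^sup>\<dagger> \<cdot> n\<close>, an identity, reduces the
    claim that \<open>w\<close> is a dagger mono to the same property of \<open>j\<close>.\<close>
  have "w\<^sup>\<dagger> \<cdot> w = (w\<^sup>\<dagger> \<cdot> (n\<^sup>\<dagger> \<cdot> n)) \<cdot> w"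
    using n(2) dagger_mono_iff[OF n(3)] Id_right[OF Dag_closed[OF w(1)]] by simp
  also have "\<dots> = j\<^sup>\<dagger> \<cdot> j"
    using w(2) Dag_Comp[OF w(1) n(3)] Comp_assoc[OF n(3) nd wd] Comp_assoc[OF w(1) n(3) Comp_closed[OF nd wd]]
    by simp
  finally have wm: "dagger_mono C w"
    using j(2) dagger_mono_iff[OF j(3)] dagger_mono_iff[OF w(1)] by simp
  obtain v V where v: "is_kernel C v (w\<^sup>\<dagger>)" "dagger_mono C v" "v \<in> Hom C V N"
    using kernel_exists[OF Dag_closed[OF w(1)]] by metis
  \<comment> \<open>The complement \<open>v\<close> of \<open>w\<close> is taken inside
    \<open>N\<close> and transported to \<open>X\<close>, so \<open>?a\<close> represents the
    complement of \<open>S\<close> relative to \<open>T\<close>.\<close>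
  let ?a = "n \<cdot> v"
  have a: "dagger_mono C ?a" "?a \<in> Hom C V X" using dagger_mono_comp v n Comp_closed by metis+
  have "j\<^sup>\<dagger> \<cdot> ?a = w\<^sup>\<dagger> \<cdot> ((n\<^sup>\<dagger> \<cdot> n) \<cdot> v)"
    using w(2) Dag_Comp[OF w(1) n(3)] Comp_assoc[OF Comp_closed[OF v(3) n(3)] nd wd]
      Comp_assoc[OF v(3) n(3) nd] by simp
  also have "\<dots> = w\<^sup>\<dagger> \<cdot> v" using n(2) dagger_mono_iff[OF n(3)] Id_left[OF v(3)] by simp
  also have "\<dots> = zero_arr C V J" using orth_perp[OF v(1) w(1)] orth_iff w v by blast
  finally have ja: "orth C j ?a" using orth_iff j a by blast
  have T': "subobject_class C ?a \<in> carrier (ClSub C X)" using subobject_class_in_ClSub a by blast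
  have "below C ?a n" using belowI v n by blast
  then have "subobject_class C ?a \<sqsubseteq>\<^bsub>ClSub C X\<^esub> T" using a n ClSub_le_iff by blast
  moreover have aj: "subobject_class C ?a \<sqsubseteq>\<^bsub>ClSub C X\<^esub> cl_perp C S"
    using ClSub_le_perp_iff ja a j by blast
  ultimately have "subobject_class C ?a \<sqsubseteq>\<^bsub>ClSub C X\<^esub> \<bottom>\<^bsub>ClSub C X\<^esub>"
    using triv meet_le cl_perp_closed S T T' by metis
  \<comment> \<open>Being below the bottom, \<open>?a\<close> also lies below \<open>j\<close>, to
    which it is orthogonal; this forces it to be a zero arrow.\<close>
  then have "subobject_class C ?a \<sqsubseteq>\<^bsub>ClSub C X\<^esub> S"
    using bottom_lower[OF S] le_trans S T' bottom_closed by blast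
  then have "below C ?a j" using a j ClSub_le_iff by blast
  then have a0: "?a = zero_arr C V X" using orth_self_zero a j ja by blast
  have VN: "zero_arr C V N \<in> Hom C V N" using zero_arr_closed Hom_Obj v by metis
  have "n \<cdot> v = n \<cdot> zero_arr C V N" using a0 comp_zero_arr n v Hom_Obj by metis
  then have v0: "v = zero_arr C V N" using mono_arrD[OF dagger_mono_mono[OF n(2)] n(3) v(3) VN] by blast
  have iN: "\<one> N \<in> Hom C N N" using Id_closed Hom_Obj w by metis
  \<comment> \<open>As \<open>v\<close> is zero, every arrow orthogonal to \<open>w\<close> is zero
    and so orthogonal to the identity. The test for dagger monos then factors the identity of
    \<open>N\<close> through \<open>w\<close>, giving a right inverse of \<open>w\<close>.\<close>
  have "orth C b (\<one> N)" if b: "b \<in> Hom C B N" "orth C b w" for B b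
  proof -
    have "below C b v" using below_perp_iff[OF v(1) w(1) b(1)] orth_sym[OF b(1) w(1) b(2)] by blast
    then obtain f where f: "f \<in> Hom C B V" "b = v \<cdot> f" using belowE b v by metis
    then have "b = zero_arr C B N" using v0 zero_arr_comp[OF f(1) Hom_Obj(2)[OF v(3)]] by simp
    then have "b\<^sup>\<dagger> \<cdot> \<one> N = zero_arr C N B"
      using Dag_zero_arr[OF Hom_Obj[OF b(1)]] Id_right[OF Dag_closed[OF b(1)]] by simp
    then show ?thesis using orth_iff[OF b(1) iN] by blast
  qed
  then have "below C (\<one> N) w" using below_dagger_mono_iff wm w iN by blast
  then obtain r where r: "r \<in> Hom C N J" "\<one> N = w \<cdot> r" using belowE iN w by metis
  have "n = j \<cdot> r" using r(2) w(2) Comp_assoc[OF r(1) w(1) n(3)] Id_right[OF n(3)] by simp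
  then have "below C n j" using belowI r j by metis
  then have "T \<sqsubseteq>\<^bsub>ClSub C X\<^esub> S" using n j ClSub_le_iff by blast
  then show ?thesis using le le_antisym S T by blast
qed

lemma ClSub_orthomodular_lattice:
  assumes X: "X \<in> Obj C"
  shows "orthomodular_lattice (ClSub C X) (cl_perp C)"
proof -
  interpret bounded_lattice "ClSub C X" using ClSub_bounded_lattice X by blast
  let ?L = "ClSub C X"
  have meet: "x \<sqinter>\<^bsub>?L\<^esub> cl_perp C x = \<bottom>\<^bsub>?L\<^esub>" if x: "x \<in> carrier ?L" for x
  proof -
    note px = cl_perp_closed[OF x]
    show ?thesis
      using below_and_perp_bottom[OF X x meet_closed[OF x px] meet_left[OF x px] meet_right[OF x px]] .
  qed
  show ?thesis
  proof
    fix x assume x: "x \<in> carrier ?L"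
    show "cl_perp C x \<in> carrier ?L" using cl_perp_closed x .
    show "cl_perp C (cl_perp C x) = x" using cl_perp_perp x .
    show "x \<sqinter>\<^bsub>?L\<^esub> cl_perp C x = \<bottom>\<^bsub>?L\<^esub>" using meet x .
    let ?j = "x \<squnion>\<^bsub>?L\<^esub> cl_perp C x"
    have j: "?j \<in> carrier ?L" "x \<sqsubseteq>\<^bsub>?L\<^esub> ?j" "cl_perp C x \<sqsubseteq>\<^bsub>?L\<^esub> ?j"
      using x cl_perp_closed join_left join_right by auto
    \<comment> \<open>The complement of the join lies below the complement of \<open>x\<close> and
      below the complement of that, so it is the bottom; \<open>below_eqI\<close> then compares the
      join with the top.\<close>
    have "cl_perp C ?j \<sqsubseteq>\<^bsub>?L\<^esub> cl_perp C x" "cl_perp C ?j \<sqsubseteq>\<^bsub>?L\<^esub> cl_perp C (cl_perp C x)"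
      using cl_perp_antimono[OF x j(1,2)] cl_perp_antimono[OF cl_perp_closed[OF x] j(1,3)] .
    then have "cl_perp C ?j = \<bottom>\<^bsub>?L\<^esub>"
      using below_and_perp_bottom[OF X cl_perp_closed[OF x] cl_perp_closed[OF j(1)]] by blast
    then have "\<top>\<^bsub>?L\<^esub> \<sqinter>\<^bsub>?L\<^esub> cl_perp C ?j = \<bottom>\<^bsub>?L\<^esub>"
      using le_antisym[OF meet_right bottom_lower] top_closed bottom_closed meet_closed by simp
    then show "?j = \<top>\<^bsub>?L\<^esub>" using below_eqI[OF X j(1) top_closed top_higher[OF j(1)]] by blast
  next
    fix x y assume "x \<in> carrier ?L" "y \<in> carrier ?L" "x \<sqsubseteq>\<^bsub>?L\<^esub> y"
    then show "cl_perp C y \<sqsubseteq>\<^bsub>?L\<^esub> cl_perp C x" using cl_perp_antimono by blast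
  next
    fix x y assume x: "x \<in> carrier ?L" and y: "y \<in> carrier ?L" and xy: "x \<sqsubseteq>\<^bsub>?L\<^esub> y"
    let ?m = "cl_perp C x \<sqinter>\<^bsub>?L\<^esub> y"
    let ?j = "x \<squnion>\<^bsub>?L\<^esub> ?m"
    let ?r = "y \<sqinter>\<^bsub>?L\<^esub> cl_perp C ?j"
    have px: "cl_perp C x \<in> carrier ?L" using cl_perp_closed x .
    have m: "?m \<in> carrier ?L" using px y by simp
    have j: "?j \<in> carrier ?L" using m x by simp
    have pj: "cl_perp C ?j \<in> carrier ?L" using cl_perp_closed j .
    have r: "?r \<in> carrier ?L" using pj y by simp
    have jy: "?j \<sqsubseteq>\<^bsub>?L\<^esub> y" using join_le[OF xy meet_right[OF px y] x m y] .
    \<comment> \<open>From \<open>x\<close> below \<open>?j\<close>, the remainder \<open>?r\<close>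
      lies below the complement of \<open>x\<close>. As it is also below \<open>y\<close>, it lies
      below \<open>?m\<close> and thus below \<open>?j\<close>. Being below the complement of
      \<open>?j\<close> too, it is the bottom.\<close>
    have "cl_perp C ?j \<sqsubseteq>\<^bsub>?L\<^esub> cl_perp C x" using cl_perp_antimono[OF x j join_left[OF x m]] .
    then have "?r \<sqsubseteq>\<^bsub>?L\<^esub> cl_perp C x" using le_trans[OF meet_right[OF y pj] _ r pj px] by blast
    then have "?r \<sqsubseteq>\<^bsub>?L\<^esub> ?m" using meet_le[OF _ meet_left[OF y pj] px y r] by blast
    then have "?r \<sqsubseteq>\<^bsub>?L\<^esub> ?j" using le_trans[OF _ join_right[OF x m] r m j] by blast
    then have "?r = \<bottom>\<^bsub>?L\<^esub>" using below_and_perp_bottom[OF X j r _ meet_right[OF y pj]] by blast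
    then show "?j = y" using below_eqI[OF X j y jy] by blast
  qed
qed

end

theorem theorem3:
  fixes H :: "('o, 'm, 'r) monoidal_dagger_category_scheme" and X :: 'o
  assumes "pre_hilbert_category H" and "X \<in> Obj H"
  shows "orthomodular_lattice (ClSub H X) (cl_perp H) \<and>
    (\<forall>m\<in>carrier (ClSub H X). \<forall>n\<in>carrier (ClSub H X).
      m \<sqinter>\<^bsub>ClSub H X\<^esub> n = cl_meet H m n \<and>
      m \<squnion>\<^bsub>ClSub H X\<^esub> n = cl_join H m n) \<and>
    (\<forall>m\<in>carrier (ClSub H X). \<forall>n\<in>carrier (ClSub H X).
      m \<sqsubseteq>\<^bsub>ClSub H X\<^esub> n \<longrightarrow> cl_join H m (cl_meet H (cl_perp H m) n) = n)"
proof -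
  interpret pre_hilbert_category H by (fact assms(1))
  interpret L: orthomodular_lattice "ClSub H X" "cl_perp H"
    using ClSub_orthomodular_lattice assms(2) .
  \<comment> \<open>The lattice operations select some greatest lower or least upper bound;
    uniqueness of bounds identifies the selected one with the categorical construction.\<close>
  have meet: "m \<sqinter>\<^bsub>ClSub H X\<^esub> n = cl_meet H m n"
    if "m \<in> carrier (ClSub H X)" "n \<in> carrier (ClSub H X)" for m n
    using L.inf_of_two_greatest[OF that] cl_meet_greatest[OF that] L.greatest_unique
    unfolding meet_def by blast
  have join: "m \<squnion>\<^bsub>ClSub H X\<^esub> n = cl_join H m n"
    if "m \<in> carrier (ClSub H X)" "n \<in> carrier (ClSub H X)" for m n
    using L.sup_of_two_least[OF that] cl_join_least[OF that] L.least_unique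
    unfolding join_def by blast
  have "cl_join H m (cl_meet H (cl_perp H m) n) = n"
    if "m \<in> carrier (ClSub H X)" "n \<in> carrier (ClSub H X)" "m \<sqsubseteq>\<^bsub>ClSub H X\<^esub> n" for m n
    using L.orthomodular[OF that] meet join that L.perp_closed L.meet_closed by metis
  then show ?thesis using meet join L.orthomodular_lattice_axioms by blast
qed

end
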